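(* Assume (A1) and (A2), and let $s>0$. If $h_k$ is a measurable function with $\eta'(h_k)\in L^\infty(\tau)$ and $g_k\in L^1(\tau)$, then there exists a unique solution $h_{k+1}\in L^1(\tau)$ to the optimization problem $$\min_{f\in L^1(\tau)}\ \int G'[g_k]\,f\,\mathrm{d}\tau+H(f)+\frac1s\Big(\int\eta(f)\,\mathrm{d}\tau-\int\eta'(h_k)\,f\,\mathrm{d}\tau\Big),$$ which moreover satisfies $\eta'(h_{k+1})\in L^\infty(\tau)$. It is characterized by the fact that there exists $\phi\in\partial H(h_{k+1})\subset L^\infty(\tau)$ such that $$G'[g_k]+\frac1s\big(\eta'(h_{k+1})-\eta'(h_k)\big)+\phi=0.$$
   Context: $\Theta$ is a compact $d$-dimensional Riemannian manifold without boundary, and $\tau$ is the probability measure on $\Theta$ proportional to the volume measure. $\mathcal{M}(\Theta)$ (resp. $\mathcal{M}_+(\Theta)$, $\mathcal{P}(\Theta)$) is the set of finite signed (resp. finite nonnegative, probability) Borel measures on $\Theta$, and $\|\mu\|$ is the total variation norm. $\iota_C$ is the convex indicator of $C$. $\operatorname{dom}$ of a function is the set where it is $<+\infty$. Objective: $\bar F=\bar G+\bar H:\mathcal{M}(\Theta)\to\mathbb{R}\cup\{+\infty\}$ with $\bar G(\mu)=R\big(\int\Phi\,\mathrm{d}\mu\big)$, under (A1): $\Phi\in\mathcal{C}^0(\Theta;\mathcal{F})$ where $\mathcal{F}$ is a Hilbert space; $R:\mathcal{F}\to\mathbb{R}$ is convex and differentiable with Lipschitz gradient $\nabla R$; $\bar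 H$ is a sum of functions from the list $\iota_{\mathcal{P}(\Theta)}$, $\iota_{\mathcal{M}_+(\Theta)}$, $\mu\mapsto\lambda\|\mu\|$, $\iota_{\{\mu:\lambda\|\mu\|\le1\}}$ (with $\lambda\ge0$), and $\bar H$ is not identically $+\infty$. For $f\in L^1(\tau)$: $G(f)=\bar G(f\tau)$, $H(f)=\bar H(f\tau)$, and $G'[f]$ is the continuous function $G'[f](\theta)=\langle\nabla R(\int\Phi f\,\mathrm{d}\tau),\Phi(\theta)\rangle_{\mathcal{F}}$. $\partial H(f)\subset L^\infty(\tau)$ is the convex subdifferential of $H:L^1(\tau)\to\mathbb{R}\cup\{+\infty\}$ in the duality $(L^1(\tau),L^\infty(\tau))$. (A2): $\eta:\mathbb{R}\to[0,\infty]$ is strictly convex (on its domain), lower semicontinuous, continuously differentiable in $\operatorname{int}(\operatorname{dom}\eta)$, with $\eta'(\operatorname{int}(\operatorname{dom}\eta))=\mathbb{R}$, and for any $c>0$, $\eta(cx)\asymp\eta(x)$ as $x\to+\infty$ (each side is bounded by a constant times the other for $x$ large). Moreover either $(\mathrm{A2})_+$: $\operatorname{dom}\eta=[0,+\infty[$ and $\eta(1)=\eta'(1)=0$; or $(\mathrm{A2})_\pm$: $\operatorname{dom}\eta=\mathbb{R}$, $\eta$ is even and $\eta(0)=\eta'(0)=0$. The condition $\eta'(h)\in L^\infty(\tau)$ includes that $h\in\operatorname{int}(\operatorname{dom}\eta)$ almost everywhere; $\eta(f)=\eta\circ f$. *)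

theory Defs
  imports "HOL-Analysis.Analysis" "HOL-Probability.Probability" "HOL-Library.Landau_Symbols"
begin

section \<open>Riemannian manifolds and their volume measure\<close>

text \<open>Only meaningful on open sets \<open>S\<close>: being differentiable with all directional derivatives of
  class $C^k$ is then the same as being of class $C^{k+1}$.\<close>

primrec Ck_on :: "nat \<Rightarrow> ('v::real_normed_vector \<Rightarrow> 'w::real_normed_vector) \<Rightarrow> 'v set \<Rightarrow> bool" where
  "Ck_on 0 f S \<longleftrightarrow> continuous_on S f"
| "Ck_on (Suc k) f S \<longleftrightarrow> (\<forall>x\<in>S. f differentiable (at x)) \<and>
     (\<forall>v. Ck_on k (\<lambda>x. frechet_derivative f (at x) v) S)"

definition smooth_on :: "('v::real_normed_vector \<Rightarrow> 'w::real_normed_vector) \<Rightarrow> 'v set \<Rightarrow> bool" where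
  "smooth_on f S \<longleftrightarrow> (\<forall>k. Ck_on k f S)"

text \<open>A chart is a pair \<open>(U, \<phi>)\<close>; the values of \<open>\<phi>\<close> outside its domain \<open>U\<close> are irrelevant.
  The dimension of the manifold is \<open>CARD('n)\<close>.\<close>

type_synonym ('m, 'n) chart = "'m set \<times> ('m \<Rightarrow> real ^ 'n)"

definition transition :: "('m, 'n) chart \<Rightarrow> ('m, 'n) chart \<Rightarrow> real ^ 'n \<Rightarrow> real ^ 'n" where
  "transition c c' = snd c' \<circ> inv_into (fst c) (snd c)"

definition smooth_atlas :: "('m::topological_space, 'n::finite) chart set \<Rightarrow> bool" where
  "smooth_atlas \<A> \<longleftrightarrow>
     (\<Union>c\<in>\<A>. fst c) = UNIV \<and>
     (\<forall>(U, \<phi>)\<in>\<A>. open U \<and> open (\<phi> ` U) \<and> homeomorphism U (\<phi> ` U) \<phi> (inv_into U \<phi>)) \<and>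
     (\<forall>c\<in>\<A>. \<forall>c'\<in>\<A>. smooth_on (transition c c') (snd c ` (fst c \<inter> fst c')))"

text \<open>A metric is given by its local expressions: \<open>g c x u v\<close> is the inner product of the tangent
  vectors with coordinates \<open>u\<close> and \<open>v\<close> in the chart \<open>c\<close>, at the point with coordinates \<open>x\<close>.\<close>

type_synonym ('m, 'n) local_metric =
  "('m, 'n) chart \<Rightarrow> real ^ 'n \<Rightarrow> real ^ 'n \<Rightarrow> real ^ 'n \<Rightarrow> real"

definition riemannian_metric ::
    "('m::topological_space, 'n::finite) chart set \<Rightarrow> ('m, 'n) local_metric \<Rightarrow> bool" where
  "riemannian_metric \<A> g \<longleftrightarrow>
     (\<forall>c\<in>\<A>. \<forall>x\<in>snd c ` fst c.
        bilinear (g c x) \<and> (\<forall>u v. g c x u v = g c x v u) \<and> (\<forall>u. u \<noteq> 0 \<longrightarrow> 0 < g c x u u)) \<and>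
     (\<forall>c\<in>\<A>. \<forall>u v. smooth_on (\<lambda>x. g c x u v) (snd c ` fst c)) \<and>
     (\<forall>c\<in>\<A>. \<forall>c'\<in>\<A>. \<forall>p\<in>fst c \<inter> fst c'. \<forall>u v.
        g c (snd c p) u v =
        g c' (snd c' p) (frechet_derivative (transition c c') (at (snd c p)) u)
                        (frechet_derivative (transition c c') (at (snd c p)) v))"

definition gram :: "('m, 'n::finite) local_metric \<Rightarrow> ('m, 'n) chart \<Rightarrow> real ^ 'n \<Rightarrow> real ^ 'n ^ 'n" where
  "gram g c x = (\<chi> i j. g c x (axis i 1) (axis j 1))"

text \<open>The volume measure is the unique Borel measure that is $\sqrt{\det (g_{ij})}\,dx$ in
  every chart.\<close>

definition is_volume_measure ::
    "('m::topological_space, 'n::finite) chart set \<Rightarrow> ('m, 'n) local_metric \<Rightarrow> 'm measure \<Rightarrow> bool" where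
  "is_volume_measure \<A> g vol \<longleftrightarrow> sets vol = sets borel \<and>
     (\<forall>c\<in>\<A>. \<forall>B\<in>sets borel. B \<subseteq> fst c \<longrightarrow>
        emeasure vol B = (\<integral>\<^sup>+x\<in>snd c ` B. ennreal (sqrt (det (gram g c x))) \<partial>lborel))"

definition is_normalized_volume ::
    "('m::topological_space, 'n::finite) chart set \<Rightarrow> ('m, 'n) local_metric \<Rightarrow> 'm measure \<Rightarrow> bool" where
  "is_normalized_volume \<A> g \<tau> \<longleftrightarrow> prob_space \<tau> \<and>
     (\<exists>vol r. is_volume_measure \<A> g vol \<and> \<tau> = scale_measure r vol)"

definition compact_riemannian_manifold ::
    "('m::t2_space, 'n::finite) chart set \<Rightarrow> ('m, 'n) local_metric \<Rightarrow> bool" where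
  "compact_riemannian_manifold \<A> g \<longleftrightarrow>
     compact (UNIV :: 'm set) \<and> smooth_atlas \<A> \<and> riemannian_metric \<A> g"

section \<open>Finite signed Borel measures\<close>

text \<open>Set functions are made to vanish outside the Borel sets, so that equal measures are equal
  as functions.\<close>

definition signed_measures :: "('m::topological_space set \<Rightarrow> real) set" where
  "signed_measures = {\<mu>. \<mu> {} = 0 \<and> (\<forall>A. A \<notin> sets borel \<longrightarrow> \<mu> A = 0) \<and>
     (\<forall>A :: nat \<Rightarrow> 'm set. range A \<subseteq> sets borel \<longrightarrow> disjoint_family A \<longrightarrow>
        (\<lambda>i. \<mu> (A i)) sums \<mu> (\<Union>i. A i))}"

definition nonneg_measures :: "('m::topological_space set \<Rightarrow> real) set" where
  "nonneg_measures = {\<mu>\<in>signed_measures. \<forall>A\<in>sets borel. 0 \<le> \<mu> A}"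

definition prob_measures :: "('m::topological_space set \<Rightarrow> real) set" where
  "prob_measures = {\<mu>\<in>nonneg_measures. \<mu> UNIV = 1}"

definition tv_norm :: "('m::topological_space set \<Rightarrow> real) \<Rightarrow> ereal" where
  "tv_norm \<mu> = (SUP P\<in>{P. finite P \<and> P \<subseteq> sets borel \<and> partition_on UNIV P}.
     ereal (\<Sum>A\<in>P. \<bar>\<mu> A\<bar>))"

text \<open>The signed measure $f\tau$.\<close>

definition density_signed :: "'m::topological_space measure \<Rightarrow> ('m \<Rightarrow> real) \<Rightarrow> 'm set \<Rightarrow> real" where
  "density_signed \<tau> f A = (if A \<in> sets borel then (LINT x:A|\<tau>. f x) else 0)"

section \<open>The objective\<close>

text \<open>Bochner integrals are only available in the library for second countable target spaces.
  To allow an arbitrary Hilbert space, the vector-valued integral is taken in the weak sense,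
  which agrees with the Bochner integral where the latter is available.\<close>

definition weak_integral :: "'m measure \<Rightarrow> ('m \<Rightarrow> 'f::real_inner) \<Rightarrow> 'f" where
  "weak_integral M f = (THE v. \<forall>w. v \<bullet> w = (\<integral>x. f x \<bullet> w \<partial>M))"

lemma weak_integral_eq_bochner:
  fixes f :: "'m \<Rightarrow> 'f::{real_inner, banach, second_countable_topology}"
  assumes "integrable M f"
  shows "weak_integral M f = (\<integral>x. f x \<partial>M)"
  unfolding weak_integral_def
proof (rule the_equality)
  show "\<forall>w. (\<integral>x. f x \<partial>M) \<bullet> w = (\<integral>x. f x \<bullet> w \<partial>M)"
    using assms by simp
next
  fix v assume "\<forall>w. v \<bullet> w = (\<integral>x. f x \<bullet> w \<partial>M)"
  then have "\<forall>w. v \<bullet> w = (\<integral>x. f x \<partial>M) \<bullet> w"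
    using assms by simp
  then show "v = (\<integral>x. f x \<partial>M)"
    by (metis vector_eq_rdot)
qed

definition gradient :: "('f::real_inner \<Rightarrow> real) \<Rightarrow> 'f \<Rightarrow> 'f" where
  "gradient R x = (THE D. GDERIV R x :> D)"

definition indicator_convex :: "'a set \<Rightarrow> 'a \<Rightarrow> ereal" where
  "indicator_convex C x = (if x \<in> C then 0 else \<infinity>)"

definition regularizers :: "(('m::topological_space set \<Rightarrow> real) \<Rightarrow> ereal) set" where
  "regularizers =
     {indicator_convex prob_measures, indicator_convex nonneg_measures} \<union>
     {\<lambda>\<mu>. ereal l * tv_norm \<mu> | l. 0 \<le> l} \<union>
     {indicator_convex {\<mu>\<in>signed_measures. ereal l * tv_norm \<mu> \<le> 1} | l. 0 \<le> l}"

text \<open>Each summand may come with its own parameter $\lambda$.\<close>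

definition A1 ::
    "('m::topological_space \<Rightarrow> 'f::{real_inner, complete_space}) \<Rightarrow> ('f \<Rightarrow> real) \<Rightarrow>
     (('m set \<Rightarrow> real) \<Rightarrow> ereal) \<Rightarrow> bool" where
  "A1 \<Phi> R Hbar \<longleftrightarrow>
     continuous_on UNIV \<Phi> \<and>
     convex_on UNIV R \<and> (\<forall>x. R differentiable (at x)) \<and> (\<exists>L. L-lipschitz_on UNIV (gradient R)) \<and>
     (\<exists>ts. set ts \<subseteq> regularizers \<and> (\<forall>\<mu>\<in>signed_measures. Hbar \<mu> = (\<Sum>t\<leftarrow>ts. t \<mu>))) \<and>
     (\<exists>\<mu>\<in>signed_measures. Hbar \<mu> \<noteq> \<infinity>)"

definition G_deriv ::
    "('m \<Rightarrow> 'f::real_inner) \<Rightarrow> ('f \<Rightarrow> real) \<Rightarrow> 'm measure \<Rightarrow> ('m \<Rightarrow> real) \<Rightarrow> 'm \<Rightarrow> real" where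
  "G_deriv \<Phi> R \<tau> f \<theta> = gradient R (weak_integral \<tau> (\<lambda>x. f x *\<^sub>R \<Phi> x)) \<bullet> \<Phi> \<theta>"

definition H_fun ::
    "(('m::topological_space set \<Rightarrow> real) \<Rightarrow> ereal) \<Rightarrow> 'm measure \<Rightarrow> ('m \<Rightarrow> real) \<Rightarrow> ereal" where
  "H_fun Hbar \<tau> f = Hbar (density_signed \<tau> f)"

text \<open>Elements of $L^1(\tau)$ and $L^\infty(\tau)$ are represented by functions, up to equality
  almost everywhere.\<close>

definition Linfty :: "'m measure \<Rightarrow> ('m \<Rightarrow> real) set" where
  "Linfty M = {f\<in>borel_measurable M. \<exists>C. AE x in M. \<bar>f x\<bar> \<le> C}"

definition subdiff ::
    "'m measure \<Rightarrow> (('m \<Rightarrow> real) \<Rightarrow> ereal) \<Rightarrow> ('m \<Rightarrow> real) \<Rightarrow> ('m \<Rightarrow> real) set" where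
  "subdiff M H f = {\<phi>\<in>Linfty M. H f \<noteq> \<infinity> \<and>
     (\<forall>g. integrable M g \<longrightarrow> H f + ereal (\<integral>x. \<phi> x * (g x - f x) \<partial>M) \<le> H g)}"

section \<open>The entropy function\<close>

definition eff_dom :: "(real \<Rightarrow> ennreal) \<Rightarrow> real set" where
  "eff_dom \<eta> = {x. \<eta> x < \<infinity>}"

text \<open>Only meaningful on the interior of the effective domain.\<close>

definition entropy_deriv :: "(real \<Rightarrow> ennreal) \<Rightarrow> real \<Rightarrow> real" where
  "entropy_deriv \<eta> = deriv (\<lambda>x. enn2real (\<eta> x))"

definition A2_plus :: "(real \<Rightarrow> ennreal) \<Rightarrow> bool" where
  "A2_plus \<eta> \<longleftrightarrow> eff_dom \<eta> = {0..} \<and> \<eta> 1 = 0 \<and> entropy_deriv \<eta> 1 = 0"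

definition A2_pm :: "(real \<Rightarrow> ennreal) \<Rightarrow> bool" where
  "A2_pm \<eta> \<longleftrightarrow> eff_dom \<eta> = UNIV \<and> (\<forall>x. \<eta> (- x) = \<eta> x) \<and> \<eta> 0 = 0 \<and> entropy_deriv \<eta> 0 = 0"

definition A2 :: "(real \<Rightarrow> ennreal) \<Rightarrow> bool" where
  "A2 \<eta> \<longleftrightarrow>
     (\<forall>x\<in>eff_dom \<eta>. \<forall>y\<in>eff_dom \<eta>. \<forall>t. x \<noteq> y \<longrightarrow> 0 < t \<longrightarrow> t < 1 \<longrightarrow>
        \<eta> ((1 - t) * x + t * y) < ennreal (1 - t) * \<eta> x + ennreal t * \<eta> y) \<and>
     (\<forall>x. \<eta> x \<le> Liminf (at x) \<eta>) \<and>
     (\<forall>x\<in>interior (eff_dom \<eta>). (\<lambda>x. enn2real (\<eta> x)) field_differentiable (at x)) \<and>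
     continuous_on (interior (eff_dom \<eta>)) (entropy_deriv \<eta>) \<and>
     entropy_deriv \<eta> ` interior (eff_dom \<eta>) = UNIV \<and>
     (\<forall>c>0. (\<lambda>x. enn2real (\<eta> (c * x))) \<in> \<Theta>[at_top](\<lambda>x. enn2real (\<eta> x))) \<and>
     (A2_plus \<eta> \<or> A2_pm \<eta>)"

definition entropy_deriv_in_Linfty :: "'m measure \<Rightarrow> (real \<Rightarrow> ennreal) \<Rightarrow> ('m \<Rightarrow> real) \<Rightarrow> bool" where
  "entropy_deriv_in_Linfty \<tau> \<eta> h \<longleftrightarrow>
     (AE x in \<tau>. h x \<in> interior (eff_dom \<eta>)) \<and> (\<lambda>x. entropy_deriv \<eta> (h x)) \<in> Linfty \<tau>"

definition step_objective ::
    "'m::topological_space measure \<Rightarrow> ('m \<Rightarrow> 'f::real_inner) \<Rightarrow> ('f \<Rightarrow> real) \<Rightarrow>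
     (('m set \<Rightarrow> real) \<Rightarrow> ereal) \<Rightarrow> (real \<Rightarrow> ennreal) \<Rightarrow> real \<Rightarrow> ('m \<Rightarrow> real) \<Rightarrow> ('m \<Rightarrow> real) \<Rightarrow>
     ('m \<Rightarrow> real) \<Rightarrow> ereal" where
  "step_objective \<tau> \<Phi> R Hbar \<eta> s g h f =
     ereal (\<integral>x. G_deriv \<Phi> R \<tau> g x * f x \<partial>\<tau>) + H_fun Hbar \<tau> f
     + ereal (1 / s) * (enn2ereal (\<integral>\<^sup>+x. \<eta> (f x) \<partial>\<tau>)
                        - ereal (\<integral>x. entropy_deriv \<eta> (h x) * f x \<partial>\<tau>))"

end

theory Submission
  imports Defs
begin

text \<open>Strict convexity of \<open>\<eta>\<close> makes the optimality condition sufficient and strictly so: integrating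
  the strict tangent inequality for \<open>\<eta>\<close> and adding the subgradient inequality for \<open>H\<close> shows that a
  point satisfying it beats every other \<open>f\<close>. So uniqueness and necessity of the condition both
  follow once a single point satisfying it is exhibited. On \<open>L\<^sup>1\<close>, \<open>H\<close> is a multiple of the norm plus
  the indicator of a norm ball, possibly with sign and mass constraints. Hence such a point is
  \<open>(\<eta>')\<^sup>-\<^sup>1\<close> of a shifted or soft-thresholded bounded function, whose threshold is a Lagrange
  multiplier found by the intermediate value theorem so that the mass or norm constraint is met.\<close>

section \<open>The entropy and its mirror map\<close>

lemma A2_interior_dom:
  assumes "A2 \<eta>"
  shows "interior (eff_dom \<eta>) = {0<..} \<and> eff_dom \<eta> = {0..} \<or> interior (eff_dom \<eta>) = UNIV \<and> eff_dom \<eta> = UNIV"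
  using assms by (auto simp: A2_def A2_plus_def A2_pm_def)

text \<open>Convexity moves from extended to real values because \<open>\<eta>\<close> is finite at
  both endpoints, which bounds the value in between by a finite number.\<close>

lemma A2_convex_on:
  assumes "A2 \<eta>"
  shows "convex_on (eff_dom \<eta>) (\<lambda>x. enn2real (\<eta> x))"
    and "\<lbrakk>x \<in> eff_dom \<eta>; y \<in> eff_dom \<eta>; x \<noteq> y; 0 < t; t < 1\<rbrakk> \<Longrightarrow>
      enn2real (\<eta> ((1 - t) * x + t * y)) < (1 - t) * enn2real (\<eta> x) + t * enn2real (\<eta> y)"
proof -
  have strict: "enn2real (\<eta> ((1 - t) * x + t * y)) < (1 - t) * enn2real (\<eta> x) + t * enn2real (\<eta> y)"
    if "x \<in> eff_dom \<eta>" "y \<in> eff_dom \<eta>" "x \<noteq> y" "0 < t" "t < 1" for x y t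
  proof -
    have fin: "\<eta> x < \<infinity>" "\<eta> y < \<infinity>" using that by (auto simp: eff_dom_def)
    have "\<eta> ((1 - t) * x + t * y) < ennreal (1 - t) * \<eta> x + ennreal t * \<eta> y"
      using assms that unfolding A2_def by blast
    also have "\<dots> = ennreal ((1 - t) * enn2real (\<eta> x) + t * enn2real (\<eta> y))"
      using fin that by (simp add: ennreal_mult' ennreal_plus)
    finally show ?thesis
      by (cases "\<eta> ((1 - t) * x + t * y)") (auto simp: ennreal_less_iff)
  qed
  show "\<lbrakk>x \<in> eff_dom \<eta>; y \<in> eff_dom \<eta>; x \<noteq> y; 0 < t; t < 1\<rbrakk> \<Longrightarrow>
      enn2real (\<eta> ((1 - t) * x + t * y)) < (1 - t) * enn2real (\<eta> x) + t * enn2real (\<eta> y)"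
    by (rule strict)
  show "convex_on (eff_dom \<eta>) (\<lambda>x. enn2real (\<eta> x))"
  proof (rule convex_onI)
    show "convex (eff_dom \<eta>)" using A2_interior_dom[OF assms] by auto
    fix t x y :: real
    assume "0 < t" "t < 1" "x \<in> eff_dom \<eta>" "y \<in> eff_dom \<eta>"
    then show "enn2real (\<eta> ((1 - t) *\<^sub>R x + t *\<^sub>R y)) \<le> (1 - t) * enn2real (\<eta> x) + t * enn2real (\<eta> y)"
      using strict[of x y t] by (cases "x = y") (auto simp: algebra_simps)
  qed
qed

lemma A2_has_derivative:
  assumes "A2 \<eta>" "x \<in> interior (eff_dom \<eta>)"
  shows "((\<lambda>x. enn2real (\<eta> x)) has_field_derivative entropy_deriv \<eta> x) (at x)"
  using assms by (simp add: A2_def entropy_deriv_def field_differentiable_derivI)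

text \<open>The weak form is the tangent bound for convex functions. For strictness it is applied at
  the midpoint \<open>m\<close>, where strict convexity puts the value strictly below the chord.
  Only the base point \<open>y\<close> must be interior: \<open>x\<close> may be the endpoint 0, a
  value that competitors of the minimizer can take.\<close>

lemma entropy_above_tangent:
  assumes "A2 \<eta>" "y \<in> interior (eff_dom \<eta>)" "x \<in> eff_dom \<eta>"
  shows "enn2real (\<eta> y) + entropy_deriv \<eta> y * (x - y) \<le> enn2real (\<eta> x)"
    and "x \<noteq> y \<Longrightarrow> enn2real (\<eta> y) + entropy_deriv \<eta> y * (x - y) < enn2real (\<eta> x)"
proof -
  have conn: "connected (eff_dom \<eta>)" using A2_interior_dom[OF assms(1)] by auto
  have tangent: "enn2real (\<eta> y) + entropy_deriv \<eta> y * (z - y) \<le> enn2real (\<eta> z)"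
    if "z \<in> eff_dom \<eta>" for z
    using convex_on_imp_above_tangent[OF A2_convex_on(1)[OF assms(1)] conn assms(2) that
        has_field_derivative_at_within[OF A2_has_derivative[OF assms(1,2)]]] by simp
  show "enn2real (\<eta> y) + entropy_deriv \<eta> y * (x - y) \<le> enn2real (\<eta> x)"
    using tangent assms(3) .
  assume "x \<noteq> y"
  have y: "y \<in> eff_dom \<eta>" using assms(2) interior_subset by blast
  define m where "m = (1 - 1/2) * y + 1/2 * x"
  have "m \<in> eff_dom \<eta>" 
    using A2_interior_dom[OF assms(1)] y assms(3) by (auto simp: m_def)
  then have "enn2real (\<eta> y) + entropy_deriv \<eta> y * (m - y) \<le> enn2real (\<eta> m)" by (rule tangent)
  moreover have "enn2real (\<eta> m) < (1 - 1/2) * enn2real (\<eta> y) + 1/2 * enn2real (\<eta> x)"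
    unfolding m_def using A2_convex_on(2)[OF assms(1) y assms(3), of "1/2"] \<open>x \<noteq> y\<close> by simp
  moreover have "entropy_deriv \<eta> y * (m - y) = entropy_deriv \<eta> y * (x - y) / 2"
    by (simp add: m_def algebra_simps)
  ultimately show "enn2real (\<eta> y) + entropy_deriv \<eta> y * (x - y) < enn2real (\<eta> x)"
    by simp
qed

text \<open>Adding the strict tangent inequalities based at \<open>x\<close> and at \<open>y\<close>
  cancels the values of \<open>\<eta>\<close>.\<close>

lemma entropy_deriv_strict_mono:
  assumes "A2 \<eta>"
  shows "strict_mono_on (interior (eff_dom \<eta>)) (entropy_deriv \<eta>)"
proof (rule strict_mono_onI)
  fix x y assume xy: "x \<in> interior (eff_dom \<eta>)" "y \<in> interior (eff_dom \<eta>)" "x < y"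
  then have "x \<in> eff_dom \<eta>" "y \<in> eff_dom \<eta>" using interior_subset by blast+
  then have "entropy_deriv \<eta> x * (y - x) + entropy_deriv \<eta> y * (x - y) < 0"
    using entropy_above_tangent(2)[OF assms xy(1), of y] entropy_above_tangent(2)[OF assms xy(2), of x] xy
    by simp
  then have "(entropy_deriv \<eta> x - entropy_deriv \<eta> y) * (y - x) < 0" by (simp add: algebra_simps)
  then show "entropy_deriv \<eta> x < entropy_deriv \<eta> y" using xy(3) by (simp add: mult_less_0_iff)
qed

text \<open>This is the derivative of the convex conjugate of \<open>\<eta>\<close>. It is
  meaningful on the whole line because the derivative of \<open>\<eta>\<close> is injective and onto
  the reals.\<close>

definition mirror_map :: "(real \<Rightarrow> ennreal) \<Rightarrow> real \<Rightarrow> real" where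
  "mirror_map \<eta> = the_inv_into (interior (eff_dom \<eta>)) (entropy_deriv \<eta>)"

lemma mirror_map:
  assumes "A2 \<eta>"
  shows "mirror_map \<eta> y \<in> interior (eff_dom \<eta>)"
    and "entropy_deriv \<eta> (mirror_map \<eta> y) = y"
    and "x \<in> interior (eff_dom \<eta>) \<Longrightarrow> mirror_map \<eta> (entropy_deriv \<eta> x) = x"
proof -
  have inj: "inj_on (entropy_deriv \<eta>) (interior (eff_dom \<eta>))"
    using entropy_deriv_strict_mono[OF assms] strict_mono_on_imp_inj_on by blast
  have surj: "y \<in> entropy_deriv \<eta> ` interior (eff_dom \<eta>)" using assms by (simp add: A2_def)
  show "mirror_map \<eta> y \<in> interior (eff_dom \<eta>)" "entropy_deriv \<eta> (mirror_map \<eta> y) = y"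
    using the_inv_into_into[OF inj surj] f_the_inv_into_f[OF inj surj] by (auto simp: mirror_map_def)
  show "x \<in> interior (eff_dom \<eta>) \<Longrightarrow> mirror_map \<eta> (entropy_deriv \<eta> x) = x"
    using the_inv_into_f_f[OF inj] by (simp add: mirror_map_def)
qed

lemma mirror_map_mono:
  assumes "A2 \<eta>" "x \<le> y"
  shows "mirror_map \<eta> x \<le> mirror_map \<eta> y"
proof (rule ccontr)
  assume "\<not> ?thesis"
  then have "y < x"
    using strict_mono_onD[OF entropy_deriv_strict_mono[OF assms(1)], of "mirror_map \<eta> y" "mirror_map \<eta> x"]
      mirror_map[OF assms(1)] by simp
  then show False using assms(2) by simp
qed

text \<open>A monotone function on the line with open range has no jumps, and the range here is the
  interior of the domain of \<open>\<eta>\<close>.\<close>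

lemma continuous_mirror_map:
  assumes "A2 \<eta>"
  shows "continuous_on UNIV (mirror_map \<eta>)"
proof (rule continuous_onI_mono)
  have "range (mirror_map \<eta>) = interior (eff_dom \<eta>)"
    using mirror_map(1)[OF assms] mirror_map(3)[OF assms, symmetric] by blast
  then show "open (range (mirror_map \<eta>))" by simp
qed (rule mirror_map_mono[OF assms])

section \<open>Borel measurability of the entropy and of its derivative\<close>

lemma borel_measurable_if_continuous_and_constant:
  fixes f :: "real \<Rightarrow> 'b::topological_space"
  assumes "continuous_on {0<..} f" "\<And>x. x < 0 \<Longrightarrow> f x = c"
  shows "f \<in> borel_measurable borel"
proof (rule borel_measurable_continuous_countable_exceptions)
  have "continuous_on {..<0} f \<longleftrightarrow> continuous_on {..<0::real} (\<lambda>_. c)"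
    by (rule continuous_on_cong) (use assms(2) in auto)
  then have "continuous_on {..<0} f" by simp
  then have "continuous_on ({..<0} \<union> {0<..}) f" using assms(1) by (intro continuous_on_open_Un) auto
  moreover have "{..<0} \<union> {0<..} = - {0::real}" by auto
  ultimately show "continuous_on (- {0}) f" by simp
qed simp

text \<open>On the interior of the domain both functions are continuous. When the domain is a
  half-line they are constant to the left of 0, and the single point 0 does not affect
  measurability.\<close>

lemma borel_measurable_entropy:
  assumes "A2 \<eta>"
  shows "entropy_deriv \<eta> \<in> borel_measurable borel" "\<eta> \<in> borel_measurable borel"
proof -
  have cont: "continuous_on (interior (eff_dom \<eta>)) (entropy_deriv \<eta>)" using assms by (simp add: A2_def)
  have "continuous_on (interior (eff_dom \<eta>)) (\<lambda>x. enn2real (\<eta> x))"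
    using A2_has_derivative[OF assms] DERIV_isCont continuous_at_imp_continuous_on by metis
  then have "continuous_on (interior (eff_dom \<eta>)) (\<lambda>x. ennreal (enn2real (\<eta> x)))"
    by (rule continuous_on_ennreal)
  moreover have fin: "ennreal (enn2real (\<eta> x)) = \<eta> x" if "x \<in> interior (eff_dom \<eta>)" for x
  proof -
    have "x \<in> eff_dom \<eta>" using that interior_subset by blast
    then show ?thesis by (simp add: eff_dom_def)
  qed
  ultimately have cont': "continuous_on (interior (eff_dom \<eta>)) \<eta>"
    using continuous_on_cong[OF refl, of "interior (eff_dom \<eta>)" "\<lambda>x. ennreal (enn2real (\<eta> x))" \<eta>] by blast
  have "entropy_deriv \<eta> \<in> borel_measurable borel \<and> \<eta> \<in> borel_measurable borel"
    using A2_interior_dom[OF assms]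
  proof (elim disjE conjE)
    assume D: "interior (eff_dom \<eta>) = {0<..}" "eff_dom \<eta> = {0..}"
    have top: "\<eta> x = \<infinity>" if "x < 0" for x
    proof -
      have "x \<notin> eff_dom \<eta>" using D(2) that by simp
      then show ?thesis by (simp add: eff_dom_def flip: top.not_eq_extremum)
    qed
    have "entropy_deriv \<eta> x = 0" if "x < 0" for x
    proof -
      \<comment> \<open>\<open>enn2real\<close> sends \<open>\<infinity>\<close> to 0, so the
        function being differentiated vanishes on the negative half-line.\<close>
      have "((\<lambda>x. enn2real (\<eta> x)) has_field_derivative 0) (at x)"
      proof (rule has_field_derivative_transform_within_open)
        show "((\<lambda>x. 0) has_field_derivative 0) (at x)" by simp
        show "open {..<0::real}" by simp
      qed (use that top in auto)
      then show ?thesis by (simp add: entropy_deriv_def DERIV_imp_deriv)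
    qed
    then show ?thesis
      using cont cont' D top by (auto intro!: borel_measurable_if_continuous_and_constant)
  next
    assume "interior (eff_dom \<eta>) = UNIV"
    then show ?thesis using cont cont' by (simp add: borel_measurable_continuous_onI)
  qed
  then show "entropy_deriv \<eta> \<in> borel_measurable borel" "\<eta> \<in> borel_measurable borel" by auto
qed

section \<open>The regularizer on integrable functions\<close>

lemma tv_norm_ge_mass: "ereal \<bar>\<mu> UNIV\<bar> \<le> tv_norm \<mu>"
  unfolding tv_norm_def
  by (rule SUP_upper2[of "{UNIV}"]) (auto simp: partition_on_def)

lemma tv_norm_nonneg: "0 \<le> tv_norm \<mu>"
  by (rule order_trans[OF _ tv_norm_ge_mass]) simp

text \<open>Here \<open>p\<close> and \<open>q\<close> record whether a mass or a sign constraint is present. \<open>\<Lambda>\<close> is the sum of the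
  norm weights, and \<open>K\<close> the largest parameter of a norm ball (\<open>K = 0\<close> when there is none).\<close>

lemma regularizers_sum:
  assumes "set ts \<subseteq> regularizers"
  shows "\<exists>p q \<Lambda> K. (p \<longrightarrow> q) \<and> 0 \<le> \<Lambda> \<and> 0 \<le> K \<and>
    (\<forall>\<mu>\<in>signed_measures. (\<Sum>t\<leftarrow>ts. t \<mu>) =
      (if (p \<longrightarrow> \<mu> \<in> prob_measures) \<and> (q \<longrightarrow> \<mu> \<in> nonneg_measures) \<and> ereal K * tv_norm \<mu> \<le> 1
       then ereal \<Lambda> * tv_norm \<mu> else \<infinity>))"
  using assms
proof (induction ts)
  case Nil
  \<comment> \<open>With \<open>K = 0\<close> the ball constraint is void even for infinite norm,
    since \<open>0 * \<infinity> = 0\<close> in the extended reals.\<close>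
  show ?case by (rule exI[of _ False], rule exI[of _ False], rule exI[of _ 0], rule exI[of _ 0])
      (auto simp flip: zero_ereal_def)
next
  case (Cons t ts)
  then have "set ts \<subseteq> regularizers" by simp
  from Cons.IH[OF this] obtain p q \<Lambda> K where IH: "p \<longrightarrow> q" "0 \<le> \<Lambda>" "0 \<le> K"
    "\<forall>\<mu>\<in>signed_measures. (\<Sum>t\<leftarrow>ts. t \<mu>) =
      (if (p \<longrightarrow> \<mu> \<in> prob_measures) \<and> (q \<longrightarrow> \<mu> \<in> nonneg_measures) \<and> ereal K * tv_norm \<mu> \<le> 1
       then ereal \<Lambda> * tv_norm \<mu> else \<infinity>)"
    by (elim exE conjE)
  have nonneg: "0 \<le> ereal l * tv_norm \<mu>" if "0 \<le> l" for l and \<mu> :: "'a set \<Rightarrow> real"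
    using that tv_norm_nonneg by (intro ereal_0_le_mult) auto
  note sum = bspec[OF IH(4)]
  consider "t = indicator_convex prob_measures" | "t = indicator_convex nonneg_measures"
    | l where "0 \<le> l" "t = (\<lambda>\<mu>. ereal l * tv_norm \<mu>)"
    | l where "0 \<le> l" "t = indicator_convex {\<mu>\<in>signed_measures. ereal l * tv_norm \<mu> \<le> 1}"
    using Cons.prems by (auto simp: regularizers_def)
  then show ?case
  proof cases
    case 1
    \<comment> \<open>Probability measures are nonnegative, so the mass constraint switches on the
      sign constraint too; this preserves \<open>p \<longrightarrow> q\<close>.\<close>
    show ?thesis
      by (rule exI[of _ True], rule exI[of _ True], rule exI[of _ \<Lambda>], rule exI[of _ K])
        (use IH(1-3) 1 in \<open>auto simp: sum indicator_convex_def prob_measures_def nonneg\<close>)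
  next
    case 2
    show ?thesis
      by (rule exI[of _ p], rule exI[of _ True], rule exI[of _ \<Lambda>], rule exI[of _ K])
        (use IH(1-3) 2 in \<open>auto simp: sum indicator_convex_def nonneg\<close>)
  next
    case 3
    show ?thesis
      by (rule exI[of _ p], rule exI[of _ q], rule exI[of _ "l + \<Lambda>"], rule exI[of _ K])
        (use IH(1-3) 3 nonneg[of l] tv_norm_nonneg in
          \<open>auto simp: sum ereal_left_distrib simp flip: plus_ereal.simps(1)\<close>)
  next
    case 4
    \<comment> \<open>A larger parameter means a smaller ball, so two balls intersect in the one
      with the larger parameter.\<close>
    define m where "m = max l K"
    have m: "0 \<le> m" using IH(3) by (simp add: m_def)
    have max: "ereal m * tv_norm \<mu> \<le> 1 \<longleftrightarrow> ereal l * tv_norm \<mu> \<le> 1 \<and> ereal K * tv_norm \<mu> \<le> 1"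
      for \<mu> :: "'a set \<Rightarrow> real"
    proof (cases "l \<le> K")
      case True
      then have "ereal l * tv_norm \<mu> \<le> ereal K * tv_norm \<mu>"
        by (intro ereal_mult_right_mono) (auto simp: tv_norm_nonneg)
      then show ?thesis using True order_trans by (auto simp: m_def max_def)
    next
      case False
      then have "ereal K * tv_norm \<mu> \<le> ereal l * tv_norm \<mu>"
        by (intro ereal_mult_right_mono) (auto simp: tv_norm_nonneg)
      then show ?thesis using False order_trans by (auto simp: m_def max_def)
    qed
    show ?thesis
      by (rule exI[of _ p], rule exI[of _ q], rule exI[of _ \<Lambda>], rule exI[of _ m])
        (use IH(1-3) 4 m in \<open>auto simp: sum max indicator_convex_def nonneg\<close>)
  qed
qed

section \<open>Integrable densities as signed measures\<close>

lemma set_integrable_borel: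
  fixes f :: "_ \<Rightarrow> real"
  assumes "sets \<tau> = sets borel" "integrable \<tau> f" "A \<in> sets borel"
  shows "set_integrable \<tau> A f"
  using assms integrable_mult_indicator[of A \<tau> f] by (simp add: set_integrable_def)

text \<open>Countable additivity is finite additivity combined with continuity of the set integral
  along the increasing finite unions.\<close>

lemma density_signed_in_signed_measures:
  assumes "sets \<tau> = sets borel" "integrable \<tau> f"
  shows "density_signed \<tau> f \<in> signed_measures"
proof -
  have "(\<lambda>i. density_signed \<tau> f (A i)) sums density_signed \<tau> f (\<Union>i. A i)"
    if A: "range A \<subseteq> sets borel" "disjoint_family A" for A :: "nat \<Rightarrow> _"
  proof -
    have sets: "A i \<in> sets \<tau>" "A i \<in> sets borel" for i using A(1) assms(1) by auto
    have "(\<lambda>n. LINT x:(\<Union>i<n. A i)|\<tau>. f x) \<longlonglongrightarrow> (LINT x:(\<Union>n. \<Union>i<n. A i)|\<tau>. f x)"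
      using sets by (intro set_integral_cont_up set_integrable_borel assms)
        (fastforce simp: incseq_def)+
    moreover have "(\<Union>n. \<Union>i<n. A i) = (\<Union>i. A i)" by auto
    moreover have "(LINT x:(\<Union>i<n. A i)|\<tau>. f x) = (\<Sum>i<n. LINT x:A i|\<tau>. f x)" for n
      using A(2) sets by (intro set_integral_finite_Union set_integrable_borel assms)
        (auto simp: disjoint_family_on_def)
    ultimately show ?thesis using sets by (auto simp: sums_def density_signed_def)
  qed
  then show ?thesis
    by (simp add: signed_measures_def density_signed_def set_lebesgue_integral_def)
qed

text \<open>The triangle inequality on each block bounds every partition sum from above. The bound
  is attained by the Hahn decomposition into the set where \<open>f\<close> is nonnegative and its
  complement.\<close>

lemma tv_norm_density_signed:
  fixes \<tau> :: "'m::topological_space measure"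
  assumes sets: "sets \<tau> = sets borel" and f: "integrable \<tau> f"
  shows "tv_norm (density_signed \<tau> f) = ereal (\<integral>x. \<bar>f x\<bar> \<partial>\<tau>)"
proof (rule antisym)
  have space: "space \<tau> = UNIV" using sets_eq_imp_space_eq[OF sets] by simp
  show "tv_norm (density_signed \<tau> f) \<le> ereal (\<integral>x. \<bar>f x\<bar> \<partial>\<tau>)"
    unfolding tv_norm_def
  proof (rule SUP_least)
    fix P :: "'m set set" assume "P \<in> {P. finite P \<and> P \<subseteq> sets borel \<and> partition_on UNIV P}"
    then have P: "finite P" "P \<subseteq> sets borel" "partition_on UNIV P" by auto
    have "(\<Sum>A\<in>P. \<bar>density_signed \<tau> f A\<bar>) = (\<Sum>A\<in>P. \<bar>LINT x:A|\<tau>. f x\<bar>)"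
      using P(2) by (intro sum.cong) (auto simp: density_signed_def)
    also have "\<dots> \<le> (\<Sum>A\<in>P. LINT x:A|\<tau>. \<bar>f x\<bar>)"
    proof (rule sum_mono)
      fix A assume "A \<in> P"
      then have "set_integrable \<tau> A f" using P set_integrable_borel[OF sets f] by blast
      from set_integral_norm_bound[OF this] show "\<bar>LINT x:A|\<tau>. f x\<bar> \<le> (LINT x:A|\<tau>. \<bar>f x\<bar>)" by simp
    qed
    also have "\<dots> = (LINT x:(\<Union>A\<in>P. A)|\<tau>. \<bar>f x\<bar>)"
      using P f sets by (intro set_integral_finite_Union[symmetric] set_integrable_borel)
        (auto simp: partition_on_def disjoint_family_on_def disjoint_def)
    also have "\<dots> = (\<integral>x. \<bar>f x\<bar> \<partial>\<tau>)"
      using partition_onD1[OF P(3)] space by (simp add: set_lebesgue_integral_def)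
    finally show "ereal (\<Sum>A\<in>P. \<bar>density_signed \<tau> f A\<bar>) \<le> ereal (\<integral>x. \<bar>f x\<bar> \<partial>\<tau>)" by simp
  qed
  define A where "A = {x. 0 \<le> f x}"
  have "{x \<in> space \<tau>. 0 \<le> f x} \<in> sets \<tau>" using f by measurable
  then have A: "A \<in> sets borel" "- A \<in> sets borel" using sets space by (auto simp: A_def)
  \<comment> \<open>Blocks of a partition must be nonempty; dropping an empty one leaves the sum
    unchanged because the measure vanishes there.\<close>
  define P where "P = {A, - A} - {{}}"
  have "(\<integral>x. \<bar>f x\<bar> \<partial>\<tau>) = (LINT x:A \<union> -A|\<tau>. \<bar>f x\<bar>)"
    using space by (simp add: set_lebesgue_integral_def)
  also have "\<dots> = (LINT x:A|\<tau>. \<bar>f x\<bar>) + (LINT x:-A|\<tau>. \<bar>f x\<bar>)"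
    using A f sets by (intro set_integral_Un set_integrable_borel) auto
  also have "(LINT x:A|\<tau>. \<bar>f x\<bar>) = (LINT x:A|\<tau>. f x)"
    using A sets by (intro set_lebesgue_integral_cong) (auto simp: A_def)
  also have "(LINT x:-A|\<tau>. \<bar>f x\<bar>) = (LINT x:-A|\<tau>. - f x)"
    using A sets by (intro set_lebesgue_integral_cong) (auto simp: A_def)
  also have "(LINT x:-A|\<tau>. - f x) = - (LINT x:-A|\<tau>. f x)"
    by (simp add: set_lebesgue_integral_def)
  also have "(LINT x:A|\<tau>. f x) + - (LINT x:-A|\<tau>. f x) \<le>
      \<bar>density_signed \<tau> f A\<bar> + \<bar>density_signed \<tau> f (- A)\<bar>"
    using A by (auto simp: density_signed_def)
  also have "\<dots> = (\<Sum>B\<in>{A, - A}. \<bar>density_signed \<tau> f B\<bar>)"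
    by (subst sum.insert) auto
  also have "\<dots> = (\<Sum>B\<in>P. \<bar>density_signed \<tau> f B\<bar>)"
    unfolding P_def by (rule sum.mono_neutral_right) (auto simp: density_signed_def set_lebesgue_integral_def)
  also have "ereal \<dots> \<le> tv_norm (density_signed \<tau> f)"
    unfolding tv_norm_def using A
    by (intro SUP_upper) (auto simp: P_def partition_on_def disjoint_def)
  finally show "ereal (\<integral>x. \<bar>f x\<bar> \<partial>\<tau>) \<le> tv_norm (density_signed \<tau> f)" by simp
qed

text \<open>Testing the measure on the set where \<open>f\<close> is negative gives minus the
  integral of the negative part, which must therefore vanish.\<close>

lemma density_signed_in_nonneg_measures:
  fixes \<tau> :: "'m::topological_space measure"
  assumes sets: "sets \<tau> = sets borel" and f: "integrable \<tau> f"
  shows "density_signed \<tau> f \<in> nonneg_measures \<longleftrightarrow> (AE x in \<tau>. 0 \<le> f x)"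
proof
  have space: "space \<tau> = UNIV" using sets_eq_imp_space_eq[OF sets] by simp
  assume nonneg: "density_signed \<tau> f \<in> nonneg_measures"
  define A where "A = {x. f x < 0}"
  have "{x \<in> space \<tau>. f x < 0} \<in> sets \<tau>" using f by measurable
  then have A: "A \<in> sets borel" using sets space by (auto simp: A_def)
  have eq: "indicator A x * f x = - max 0 (- f x)" for x by (auto simp: A_def indicator_def)
  have "0 \<le> (LINT x:A|\<tau>. f x)"
    using nonneg A unfolding nonneg_measures_def density_signed_def by auto
  also have "\<dots> = - (\<integral>x. max 0 (- f x) \<partial>\<tau>)" by (simp add: set_lebesgue_integral_def eq)
  finally have "(\<integral>x. max 0 (- f x) \<partial>\<tau>) \<le> 0" by simp
  moreover have "0 \<le> (\<integral>x. max 0 (- f x) \<partial>\<tau>)" by (rule Bochner_Integration.integral_nonneg) auto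
  ultimately have "(\<integral>x. max 0 (- f x) \<partial>\<tau>) = 0" by simp
  then have "AE x in \<tau>. max 0 (- f x) = 0"
    using f by (subst (asm) integral_nonneg_eq_0_iff_AE) auto
  then show "AE x in \<tau>. 0 \<le> f x" by eventually_elim auto
next
  assume "AE x in \<tau>. 0 \<le> f x"
  then have "0 \<le> (LINT x:A|\<tau>. f x)" for A
    unfolding set_lebesgue_integral_def
    by (intro integral_nonneg_AE) (auto elim!: eventually_mono)
  then show "density_signed \<tau> f \<in> nonneg_measures"
    using density_signed_in_signed_measures[OF assms] by (auto simp: nonneg_measures_def density_signed_def)
qed

lemma density_signed_UNIV:
  assumes "sets \<tau> = sets borel"
  shows "density_signed \<tau> f UNIV = (\<integral>x. f x \<partial>\<tau>)"
  using sets_eq_imp_space_eq[OF assms] by (simp add: density_signed_def set_lebesgue_integral_def)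

lemma density_signed_cong_AE:
  assumes "sets \<tau> = sets borel" "integrable \<tau> f" "integrable \<tau> g" "AE x in \<tau>. f x = g x"
  shows "density_signed \<tau> f = density_signed \<tau> g"
proof
  fix A
  show "density_signed \<tau> f A = density_signed \<tau> g A"
  proof (cases "A \<in> sets borel")
    case True
    then have "(LINT x:A|\<tau>. f x) = (LINT x:A|\<tau>. g x)"
      unfolding set_lebesgue_integral_def using assms
      by (intro integral_cong_AE borel_measurable_scaleR borel_measurable_indicator) (auto elim!: eventually_mono)
    then show ?thesis by (simp add: density_signed_def)
  qed (simp add: density_signed_def)
qed

text \<open>The bound on \<open>K\<close> comes from \<open>Hbar\<close> being finite somewhere: a
  probability measure has norm at least 1, so a ball containing one has \<open>K \<le> 1\<close>.
  The measure with finite value may have no density, but this numerical consequence is what keeps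
  mass and ball constraints compatible for densities.\<close>

lemma H_fun_L1:
  fixes \<tau> :: "'m::topological_space measure"
  assumes "A1 \<Phi> R Hbar" "prob_space \<tau>" "sets \<tau> = sets borel"
  obtains p q \<Lambda> K where "p \<longrightarrow> q" "0 \<le> \<Lambda>" "0 \<le> K" "p \<longrightarrow> K \<le> 1"
    "\<And>f. integrable \<tau> f \<Longrightarrow> H_fun Hbar \<tau> f =
      (if (p \<longrightarrow> (\<integral>x. f x \<partial>\<tau>) = 1) \<and> (q \<longrightarrow> (AE x in \<tau>. 0 \<le> f x)) \<and> K * (\<integral>x. \<bar>f x\<bar> \<partial>\<tau>) \<le> 1
       then ereal (\<Lambda> * (\<integral>x. \<bar>f x\<bar> \<partial>\<tau>)) else \<infinity>)"
proof -
  obtain ts where ts: "set ts \<subseteq> regularizers" "\<And>\<mu>. \<mu> \<in> signed_measures \<Longrightarrow> Hbar \<mu> = (\<Sum>t\<leftarrow>ts. t \<mu>)"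
    using assms(1) by (auto simp: A1_def)
  obtain \<mu> where \<mu>: "\<mu> \<in> signed_measures" "Hbar \<mu> \<noteq> \<infinity>" using assms(1) by (auto simp: A1_def)
  obtain p q \<Lambda> K where pq: "p \<longrightarrow> q" "0 \<le> \<Lambda>" "0 \<le> K" and
    sum: "\<And>\<mu>. \<mu> \<in> signed_measures \<Longrightarrow> (\<Sum>t\<leftarrow>ts. t \<mu>) =
      (if (p \<longrightarrow> \<mu> \<in> prob_measures) \<and> (q \<longrightarrow> \<mu> \<in> nonneg_measures) \<and> ereal K * tv_norm \<mu> \<le> 1
       then ereal \<Lambda> * tv_norm \<mu> else \<infinity>)"
    using regularizers_sum[OF ts(1)] by metis
  have "K \<le> 1" if p
  proof -
    have \<mu>': "\<mu> \<in> prob_measures" "ereal K * tv_norm \<mu> \<le> 1"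
      using \<mu> ts(2)[OF \<mu>(1)] sum[OF \<mu>(1)] that by (auto split: if_splits)
    have "ereal K * 1 \<le> ereal K * tv_norm \<mu>"
      using tv_norm_ge_mass[of \<mu>] \<mu>'(1) pq(3)
      by (intro ereal_mult_left_mono) (auto simp: prob_measures_def one_ereal_def)
    then have "ereal K * 1 \<le> 1" using \<mu>'(2) by (rule order_trans)
    then show ?thesis by (simp add: one_ereal_def)
  qed
  moreover have "H_fun Hbar \<tau> f =
      (if (p \<longrightarrow> (\<integral>x. f x \<partial>\<tau>) = 1) \<and> (q \<longrightarrow> (AE x in \<tau>. 0 \<le> f x)) \<and> K * (\<integral>x. \<bar>f x\<bar> \<partial>\<tau>) \<le> 1
       then ereal (\<Lambda> * (\<integral>x. \<bar>f x\<bar> \<partial>\<tau>)) else \<infinity>)" if f: "integrable \<tau> f" for f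
    using pq(1) density_signed_in_signed_measures[OF assms(3) f]
    by (auto simp: H_fun_def ts(2) sum tv_norm_density_signed[OF assms(3) f] prob_measures_def
        density_signed_in_nonneg_measures[OF assms(3) f] density_signed_UNIV[OF assms(3)])
  ultimately show thesis using that pq by blast
qed

section \<open>Thresholding and the multiplier\<close>

text \<open>With \<open>a\<close> set when \<open>\<eta>\<close> has domain \<open>[0, \<infinity>)\<close> and \<open>q\<close> when \<open>f \<ge> 0\<close> is imposed, the minimizer of
  \<open>\<eta> y - t * y + m * \<bar>y\<bar>\<close> is \<open>mirror_map \<eta> (shrink a q m t)\<close>, provided \<open>m \<ge> 0\<close>
  when neither is set.\<close>

definition shrink :: "bool \<Rightarrow> bool \<Rightarrow> real \<Rightarrow> real \<Rightarrow> real" where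
  "shrink a q m t = (if a then t - m else if q then max 0 (t - m) else max 0 (t - m) + min 0 (t + m))"

lemma shrink_bound: "\<bar>shrink a q m t\<bar> \<le> \<bar>t\<bar> + \<bar>m\<bar>"
  by (auto simp: shrink_def)

lemma borel_measurable_shrink [measurable]: "shrink a q m \<in> borel_measurable borel"
  unfolding shrink_def by simp

lemma continuous_on_shrink: "continuous_on S (\<lambda>m. shrink a q m t)"
  by (cases a; cases q) (auto simp: shrink_def intro!: continuous_intros)

text \<open>In the even case the derivative of \<open>\<eta>\<close> vanishes at 0, so its monotone
  inverse fixes 0 and respects signs.\<close>

lemma mirror_map_sgn:
  assumes "A2 \<eta>" "\<not> A2_plus \<eta>"
  shows "0 \<le> y \<Longrightarrow> 0 \<le> mirror_map \<eta> y" "y \<le> 0 \<Longrightarrow> mirror_map \<eta> y \<le> 0" "mirror_map \<eta> 0 = 0"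
proof -
  have "A2_pm \<eta>" using assms by (auto simp: A2_def)
  then show 0: "mirror_map \<eta> 0 = 0"
    using mirror_map(3)[OF assms(1), of 0] by (simp add: A2_pm_def)
  show "0 \<le> y \<Longrightarrow> 0 \<le> mirror_map \<eta> y" "y \<le> 0 \<Longrightarrow> mirror_map \<eta> y \<le> 0"
    using mirror_map_mono[OF assms(1), of 0 y] mirror_map_mono[OF assms(1), of y 0] 0 by auto
qed

lemma mirror_map_pos:
  assumes "A2 \<eta>" "A2_plus \<eta>"
  shows "0 < mirror_map \<eta> y"
  using mirror_map(1)[OF assms(1), of y] assms(2) by (simp add: A2_plus_def)

lemma mirror_map_shrink_nonneg:
  assumes "A2 \<eta>" "A2_plus \<eta> \<or> q"
  shows "0 \<le> mirror_map \<eta> (shrink (A2_plus \<eta>) q m t)"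
  using assms mirror_map_pos[OF assms(1)] mirror_map_sgn(1)[OF assms(1)]
  by (cases "A2_plus \<eta>") (auto simp: shrink_def less_imp_le)

text \<open>This says that \<open>t - T\<close> is a subgradient at \<open>h\<close> of
  \<open>m\<close> times the absolute value, restricted to nonnegative arguments under
  \<open>q\<close>. Outside the dead zone \<open>t - T\<close> is \<open>m\<close> or
  \<open>-m\<close> in agreement with the sign of \<open>h\<close>. Inside it \<open>T = 0\<close>
  and \<open>h = 0\<close>, while \<open>t\<close> is bounded by \<open>m\<close> in absolute value,
  or only from above under \<open>q\<close>.\<close>

lemma shrink_subgradient:
  fixes m t y :: real
  assumes "A2 \<eta>" "q \<or> 0 \<le> m" "q \<longrightarrow> 0 \<le> y"
  defines "T \<equiv> shrink (A2_plus \<eta>) q m t"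
  defines "h \<equiv> mirror_map \<eta> T"
  shows "(t - T) * (y - h) \<le> m * (\<bar>y\<bar> - \<bar>h\<bar>)"
proof -
  \<comment> \<open>Under \<open>q\<close> both sides are equal, which is what admits a negative
    \<open>m\<close>.\<close>
  have signed: "m * (y - h) \<le> m * (\<bar>y\<bar> - h)"
  proof (cases q)
    case False
    then show ?thesis using assms(2) by (intro mult_left_mono) auto
  qed (use assms(3) in simp)
  show ?thesis
  proof (cases "A2_plus \<eta>")
    case True
    then show ?thesis using signed mirror_map_pos[OF assms(1) True, of T]
      by (simp add: h_def T_def shrink_def)
  next
    case False
    note sgn = mirror_map_sgn[OF assms(1) False]
    show ?thesis
    proof (cases "m \<le> t")
      case True
      then have "T = t - m" "0 \<le> h"
        using False assms(2) sgn(1)[of "t - m"] by (auto simp: h_def T_def shrink_def)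
      then show ?thesis using signed by simp
    next
      case tm: False
      show ?thesis
      proof (cases "q \<or> - m \<le> t")
        case True
        then have "T = 0" "h = 0" using False tm sgn(3) by (auto simp: h_def T_def shrink_def)
        moreover have "t * y \<le> m * \<bar>y\<bar>"
        proof (cases q)
          case True
          then show ?thesis using tm assms(3) by (simp add: mult_right_mono)
        next
          case False
          then have "\<bar>t\<bar> \<le> m" using True tm by auto
          then have "\<bar>t\<bar> * \<bar>y\<bar> \<le> m * \<bar>y\<bar>" by (rule mult_right_mono) simp
          then show ?thesis using abs_ge_self[of "t * y"] by (simp add: abs_mult)
        qed
        ultimately show ?thesis by simp
      next
        case q: False
        then have "T = t + m" "h \<le> 0"
          using False tm assms(2) sgn(2)[of "t + m"] by (auto simp: h_def T_def shrink_def)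
        moreover have "- m * y \<le> m * \<bar>y\<bar>"
          using q assms(2) mult_left_mono[of "- y" "\<bar>y\<bar>" m] by simp
        ultimately show ?thesis by (simp add: algebra_simps)
      qed
    qed
  qed
qed

text \<open>This gives the upper end of the bracket for the multiplier. For such \<open>m\<close>
  either \<open>t - m\<close> lies below the derivative of \<open>\<eta>\<close> at
  \<open>r\<close>, or the threshold exceeds \<open>\<bar>t\<bar>\<close> and the result is cut to
  0.\<close>

lemma mirror_map_shrink_le:
  assumes "A2 \<eta>" "\<bar>t\<bar> \<le> C" "C + \<bar>entropy_deriv \<eta> r\<bar> \<le> m" "0 < r"
  shows "\<bar>mirror_map \<eta> (shrink (A2_plus \<eta>) q m t)\<bar> \<le> r"
proof -
  have r: "mirror_map \<eta> (entropy_deriv \<eta> r) = r"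
    using mirror_map(3)[OF assms(1), of r] A2_interior_dom[OF assms(1)] assms(4) by auto
  show ?thesis
  proof (cases "A2_plus \<eta>")
    case True
    then have "mirror_map \<eta> (shrink (A2_plus \<eta>) q m t) \<le> mirror_map \<eta> (entropy_deriv \<eta> r)"
      using assms by (intro mirror_map_mono) (auto simp: shrink_def)
    then show ?thesis using r mirror_map_pos[OF assms(1) True] by (simp add: less_imp_le)
  next
    case False
    then have "shrink (A2_plus \<eta>) q m t = 0" using assms by (auto simp: shrink_def)
    then show ?thesis using assms mirror_map_sgn(3)[OF assms(1) False] by simp
  qed
qed

text \<open>This gives the lower end of the bracket, where \<open>t - m\<close> exceeds the
  derivative of \<open>\<eta>\<close> at \<open>r\<close>. The last hypothesis excludes two-sided
  shrinkage, which for very negative \<open>m\<close> equals \<open>2 * t\<close> and does not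
  grow.\<close>

lemma mirror_map_shrink_ge:
  assumes "A2 \<eta>" "\<bar>t\<bar> \<le> C" "C + \<bar>entropy_deriv \<eta> r\<bar> \<le> - m" "0 < r" "A2_plus \<eta> \<or> q"
  shows "r \<le> mirror_map \<eta> (shrink (A2_plus \<eta>) q m t)"
proof -
  have "mirror_map \<eta> (entropy_deriv \<eta> r) \<le> mirror_map \<eta> (shrink (A2_plus \<eta>) q m t)"
    using assms by (intro mirror_map_mono) (auto simp: shrink_def)
  then show ?thesis
    using mirror_map(3)[OF assms(1), of r] A2_interior_dom[OF assms(1)] assms(4) by auto
qed

section \<open>Continuity in the multiplier and its existence\<close>

lemma continuous_on_integral_bounded:
  fixes F :: "real \<Rightarrow> 'a \<Rightarrow> real"
  assumes "finite_measure M" "\<And>c. F c \<in> borel_measurable M"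
    and "\<And>x. continuous_on S (\<lambda>c. F c x)" "\<And>c x. c \<in> S \<Longrightarrow> \<bar>F c x\<bar> \<le> B"
  shows "continuous_on S (\<lambda>c. \<integral>x. F c x \<partial>M)"
  unfolding continuous_on_sequentially comp_def
proof (intro allI ballI impI)
  interpret finite_measure M by fact
  fix u c assume c: "c \<in> S" "(\<forall>n. u n \<in> S) \<and> u \<longlonglongrightarrow> c"
  show "(\<lambda>n. \<integral>x. F (u n) x \<partial>M) \<longlonglongrightarrow> (\<integral>x. F c x \<partial>M)"
  proof (rule integral_dominated_convergence)
    show "AE x in M. (\<lambda>n. F (u n) x) \<longlonglongrightarrow> F c x"
      using assms(3) c unfolding continuous_on_sequentially comp_def by auto
    show "integrable M (\<lambda>x. B)" by simp
  qed (use assms c in auto)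
qed

lemma mirror_map_bound:
  assumes "A2 \<eta>" "\<bar>y\<bar> \<le> D"
  shows "\<bar>mirror_map \<eta> y\<bar> \<le> \<bar>mirror_map \<eta> D\<bar> + \<bar>mirror_map \<eta> (- D)\<bar>"
  using mirror_map_mono[OF assms(1), of y D] mirror_map_mono[OF assms(1), of "- D" y] assms(2) by linarith

lemma borel_measurable_mirror_map:
  assumes "A2 \<eta>"
  shows "mirror_map \<eta> \<in> borel_measurable borel"
  using continuous_mirror_map[OF assms] by (rule borel_measurable_continuous_onI)

lemma integrable_mirror_map_shrink:
  assumes "finite_measure M" "A2 \<eta>" "t \<in> borel_measurable M" "\<And>x. \<bar>t x\<bar> \<le> C"
  shows "integrable M (\<lambda>x. mirror_map \<eta> (shrink a q m (t x)))"
proof -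
  interpret finite_measure M by fact
  note [measurable] = assms(3) borel_measurable_mirror_map[OF assms(2)]
  have "\<bar>shrink a q m (t x)\<bar> \<le> C + \<bar>m\<bar>" for x
    using shrink_bound[of a q m "t x"] assms(4)[of x] by simp
  from mirror_map_bound[OF assms(2) this] show ?thesis
    by (intro integrable_const_bound) auto
qed

text \<open>The conclusion is complementary slackness. Under a mass constraint \<open>m\<close>
  adjusts the mass to 1 and may have any sign. Otherwise \<open>m = \<Lambda>\<close> if the ball
  constraint then holds, and else \<open>m\<close> is raised until the constraint is tight.
  Continuity of \<open>N\<close> and the two bracketing bounds make the intermediate value theorem
  applicable.\<close>

lemma multiplier_exists:
  assumes "prob_space M" "A2 \<eta>" "t \<in> borel_measurable M" "\<And>x. \<bar>t x\<bar> \<le> C"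
    and "p \<longrightarrow> q" "0 \<le> \<Lambda>" "0 \<le> K" "p \<longrightarrow> K \<le> 1"
  defines "N \<equiv> \<lambda>m. \<integral>x. \<bar>mirror_map \<eta> (shrink (A2_plus \<eta>) q m (t x))\<bar> \<partial>M"
  shows "\<exists>m. p \<and> N m = 1 \<or> \<Lambda> \<le> m \<and> K * N m \<le> 1 \<and> (m = \<Lambda> \<or> K * N m = 1) \<and> \<not> p"
proof -
  interpret prob_space M by fact
  note [measurable] = assms(3) borel_measurable_mirror_map[OF assms(2)]
  define h where "h m x = mirror_map \<eta> (shrink (A2_plus \<eta>) q m (t x))" for m x
  have h_meas [measurable]: "h m \<in> borel_measurable M" for m unfolding h_def by measurable
  \<comment> \<open>For \<open>m\<close> in a bounded interval the integrands share a constant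
    bound, so dominated convergence applies.\<close>
  have cont: "continuous_on {a..b} N" for a b
  proof -
    have "\<bar>shrink (A2_plus \<eta>) q m (t x)\<bar> \<le> C + max \<bar>a\<bar> \<bar>b\<bar>" if "m \<in> {a..b}" for m x
      using shrink_bound[of "A2_plus \<eta>" q m "t x"] assms(4)[of x] that by auto
    from mirror_map_bound[OF assms(2) this]
    obtain B where "\<And>m x. m \<in> {a..b} \<Longrightarrow> \<bar>h m x\<bar> \<le> B"
      unfolding h_def by blast
    moreover have "continuous_on {a..b} (\<lambda>m. h m x)" for x
      unfolding h_def using continuous_on_compose2[OF continuous_mirror_map[OF assms(2)] continuous_on_shrink]
      by blast
    ultimately show ?thesis
      unfolding N_def h_def[symmetric]
      by (intro continuous_on_integral_bounded continuous_intros finite_measure_axioms) auto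
  qed
  have int: "integrable M (\<lambda>x. \<bar>h m x\<bar>)" for m
    unfolding h_def using integrable_mirror_map_shrink[OF finite_measure_axioms assms(2-4)] by simp
  have C: "0 \<le> C" using assms(4) abs_ge_zero order_trans by blast
  have N_le: "N m \<le> r" if "C + \<bar>entropy_deriv \<eta> r\<bar> \<le> m" "0 < r" for m r
    using integral_mono[OF int[of m], of "\<lambda>x. r"] mirror_map_shrink_le[OF assms(2) assms(4) that]
    by (simp add: N_def h_def prob_space)
  have N_ge: "r \<le> N m" if "C + \<bar>entropy_deriv \<eta> r\<bar> \<le> - m" "0 < r" q for m r
    using integral_mono[OF _ int[of m], of "\<lambda>x. r"] mirror_map_shrink_ge[OF assms(2) assms(4) that(1,2), of q] that(3)
    by (fastforce simp: N_def h_def prob_space intro: order_trans[OF _ abs_ge_self])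
  show ?thesis
  proof (cases p)
    case True
    \<comment> \<open>The integrand is at most 1 for \<open>m = b\<close> and at least 1 for
      \<open>m = - b\<close>, so \<open>N\<close> crosses 1 in between.\<close>
    define b where "b = C + \<bar>entropy_deriv \<eta> 1\<bar>"
    have "\<exists>m\<ge>-b. m \<le> b \<and> N m = 1"
      using True assms(5) C by (intro IVT2' N_le N_ge cont) (auto simp: b_def)
    then show ?thesis using True by blast
  next
    case False
    show ?thesis
    proof (cases "K * N \<Lambda> \<le> 1")
      case True
      then show ?thesis using False by blast
    next
      case KN: False
      then have K: "0 < K" using assms(7) by (cases "K = 0") auto
      \<comment> \<open>The maximum makes the interval from \<open>\<Lambda>\<close> to
        \<open>b\<close> nonempty. At its left end \<open>N\<close> exceeds the radius
        \<open>1 / K\<close>, at its right end it does not.\<close>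
      define b where "b = max \<Lambda> (C + \<bar>entropy_deriv \<eta> (1 / K)\<bar>)"
      have "\<exists>m\<ge>\<Lambda>. m \<le> b \<and> N m = 1 / K"
      proof (intro IVT2' N_le cont)
        show "1 / K \<le> N \<Lambda>" using KN K by (simp add: field_simps)
      qed (use K in \<open>auto simp: b_def\<close>)
      then obtain m where "\<Lambda> \<le> m" "N m = 1 / K" by blast
      then show ?thesis using False K by (intro exI[of _ m]) auto
    qed
  qed
qed

section \<open>The optimality condition\<close>

lemma Linfty_mult_integrable:
  assumes "\<phi> \<in> Linfty M" "integrable M f"
  shows "integrable M (\<lambda>x. \<phi> x * f x)"
proof -
  obtain C where C: "AE x in M. \<bar>\<phi> x\<bar> \<le> C" and [measurable]: "\<phi> \<in> borel_measurable M"
    using assms(1) by (auto simp: Linfty_def)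
  note [measurable] = borel_measurable_integrable[OF assms(2)]
  show ?thesis
  proof (rule Bochner_Integration.integrable_bound)
    show "integrable M (\<lambda>x. C * f x)" using assms(2) by simp
    show "AE x in M. norm (\<phi> x * f x) \<le> norm (C * f x)"
      using C by eventually_elim (auto simp: abs_mult intro!: mult_right_mono)
  qed simp
qed

lemma nn_integral_enn2real:
  assumes [measurable]: "u \<in> borel_measurable M" and fin: "(\<integral>\<^sup>+x. u x \<partial>M) \<noteq> \<infinity>"
  shows "AE x in M. u x < \<infinity>" "integrable M (\<lambda>x. enn2real (u x))"
    "(\<integral>\<^sup>+x. u x \<partial>M) = ennreal (\<integral>x. enn2real (u x) \<partial>M)"
proof -
  show ae: "AE x in M. u x < \<infinity>"
    using nn_integral_PInf_AE[OF assms] by eventually_elim (simp add: top.not_eq_extremum)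
  have eq: "(\<integral>\<^sup>+x. u x \<partial>M) = (\<integral>\<^sup>+x. ennreal (enn2real (u x)) \<partial>M)"
    using ae by (intro nn_integral_cong_AE) (auto elim!: eventually_mono)
  show int: "integrable M (\<lambda>x. enn2real (u x))"
    using fin by (intro integrableI_nonneg) (auto simp: eq top.not_eq_extremum)
  show "(\<integral>\<^sup>+x. u x \<partial>M) = ennreal (\<integral>x. enn2real (u x) \<partial>M)"
    unfolding eq using int by (intro nn_integral_eq_integral) auto
qed

text \<open>The tangent at \<open>h x\<close>, evaluated at the domain point 1, bounds
  \<open>\<eta> (h x)\<close> by \<open>\<eta> 1\<close> minus a bounded factor times
  \<open>1 - h x\<close>, which is integrable.\<close>

lemma entropy_finite_if_entropy_deriv_in_Linfty:
  assumes "A2 \<eta>" "finite_measure M" "integrable M h" "entropy_deriv_in_Linfty M \<eta> h"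
  shows "(\<integral>\<^sup>+x. \<eta> (h x) \<partial>M) \<noteq> \<infinity>"
proof -
  interpret finite_measure M by fact
  let ?d = "\<lambda>x. entropy_deriv \<eta> (h x)"
  have d: "?d \<in> Linfty M" and dom: "AE x in M. h x \<in> interior (eff_dom \<eta>)"
    using assms(4) by (auto simp: entropy_deriv_in_Linfty_def)
  have one: "1 \<in> eff_dom \<eta>" using A2_interior_dom[OF assms(1)] by auto
  define b where "b x = enn2real (\<eta> 1) - ?d x * (1 - h x)" for x
  have b: "integrable M b" unfolding b_def
    by (intro Bochner_Integration.integrable_diff Linfty_mult_integrable[OF d]) (use assms(3) in auto)
  have "(\<integral>\<^sup>+x. \<eta> (h x) \<partial>M) \<le> (\<integral>\<^sup>+x. ennreal (norm (b x)) \<partial>M)"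
  proof (rule nn_integral_mono_AE)
    show "AE x in M. \<eta> (h x) \<le> ennreal (norm (b x))"
      using dom
    proof eventually_elim
      fix x assume x: "h x \<in> interior (eff_dom \<eta>)"
      then have "h x \<in> eff_dom \<eta>" using interior_subset by blast
      then have "\<eta> (h x) = ennreal (enn2real (\<eta> (h x)))" by (simp add: eff_dom_def)
      also have "\<dots> \<le> ennreal (norm (b x))"
        using entropy_above_tangent(1)[OF assms(1) x one] by (intro ennreal_leI) (simp add: b_def)
      finally show "\<eta> (h x) \<le> ennreal (norm (b x))" .
    qed
  qed
  also have "\<dots> < \<infinity>" using b by (simp add: integrable_iff_bounded)
  finally show ?thesis by simp
qed

text \<open>When \<open>J f\<close> is finite, it exceeds \<open>J h\<close> by at least
  \<open>1 / s\<close> times the integrated Bregman divergence of \<open>\<eta>\<close> from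
  \<open>h\<close> to \<open>f\<close>. This divergence is nonnegative and vanishes only if
  \<open>f\<close> and \<open>h\<close> agree almost everywhere.\<close>

lemma optimality_condition_sufficient:
  fixes H :: "('m \<Rightarrow> real) \<Rightarrow> ereal"
  assumes "A2 \<eta>" "finite_measure M" "0 < s" "G \<in> Linfty M" "k \<in> Linfty M"
    and H_nonneg: "\<And>f. integrable M f \<Longrightarrow> 0 \<le> H f"
    and h: "integrable M h" "entropy_deriv_in_Linfty M \<eta> h"
    and \<phi>: "\<phi> \<in> subdiff M H h"
    and opt: "AE x in M. G x + (1 / s) * (entropy_deriv \<eta> (h x) - k x) + \<phi> x = 0"
    and f: "integrable M f"
  defines "J \<equiv> \<lambda>f. ereal (\<integral>x. G x * f x \<partial>M) + H f
    + ereal (1 / s) * (enn2ereal (\<integral>\<^sup>+x. \<eta> (f x) \<partial>M) - ereal (\<integral>x. k x * f x \<partial>M))"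
  shows "J h \<le> J f" and "J f \<le> J h \<Longrightarrow> AE x in M. f x = h x"
proof -
  interpret finite_measure M by fact
  note [measurable] = borel_measurable_entropy[OF assms(1)]
    borel_measurable_integrable[OF h(1)] borel_measurable_integrable[OF f]
  let ?e = "\<lambda>x. enn2real (\<eta> x)" and ?d = "\<lambda>x. entropy_deriv \<eta> (h x)"
  have \<phi>_Linfty: "\<phi> \<in> Linfty M" and "H h \<noteq> \<infinity>"
    and subgrad: "H h + ereal (\<integral>x. \<phi> x * (f x - h x) \<partial>M) \<le> H f"
    using \<phi> f by (auto simp: subdiff_def)
  then obtain a where a: "H h = ereal a" using H_nonneg[OF h(1)] by (cases "H h") auto
  have fin_h: "(\<integral>\<^sup>+x. \<eta> (h x) \<partial>M) \<noteq> \<infinity>"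
    by (rule entropy_finite_if_entropy_deriv_in_Linfty[OF assms(1,2) h])
  have eh: "integrable M (\<lambda>x. ?e (h x))" "(\<integral>\<^sup>+x. \<eta> (h x) \<partial>M) = ennreal (\<integral>x. ?e (h x) \<partial>M)"
    using nn_integral_enn2real[OF _ fin_h] by auto
  have Jh: "J h = ereal ((\<integral>x. G x * h x \<partial>M) + a + (1 / s) * ((\<integral>x. ?e (h x) \<partial>M) - (\<integral>x. k x * h x \<partial>M)))"
    by (simp add: J_def a eh(2) enn2ereal_ennreal Bochner_Integration.integral_nonneg)
  have "J h \<le> J f \<and> (J f \<le> J h \<longrightarrow> (AE x in M. f x = h x))"
  proof (cases "H f = \<infinity> \<or> (\<integral>\<^sup>+x. \<eta> (f x) \<partial>M) = \<infinity>")
    case True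
    \<comment> \<open>Neither \<open>H\<close> nor the entropy term can be
      \<open>- \<infinity>\<close>, so one infinite term makes \<open>J f\<close> infinite.\<close>
    have "H f \<noteq> - \<infinity>" using H_nonneg[OF f] by auto
    moreover have "ereal (1 / s) * (enn2ereal u - ereal r) \<noteq> - \<infinity>" for u r
      using assms(3) enn2ereal_nonneg[of u] by (cases "enn2ereal u") auto
    ultimately have "J f = \<infinity>" using True assms(3) by (cases "H f") (auto simp: J_def)
    then show ?thesis by (simp add: Jh)
  next
    case False
    then obtain b where b: "H f = ereal b" using H_nonneg[OF f] by (cases "H f") auto
    have fin_f: "(\<integral>\<^sup>+x. \<eta> (f x) \<partial>M) \<noteq> \<infinity>" using False by simp
    have ef: "AE x in M. \<eta> (f x) < \<infinity>" "integrable M (\<lambda>x. ?e (f x))"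
      "(\<integral>\<^sup>+x. \<eta> (f x) \<partial>M) = ennreal (\<integral>x. ?e (f x) \<partial>M)"
      using nn_integral_enn2real[OF _ fin_f] by auto
    have Jf: "J f = ereal ((\<integral>x. G x * f x \<partial>M) + b + (1 / s) * ((\<integral>x. ?e (f x) \<partial>M) - (\<integral>x. k x * f x \<partial>M)))"
      by (simp add: J_def b ef(3) enn2ereal_ennreal Bochner_Integration.integral_nonneg)
    have d: "?d \<in> Linfty M" and dom: "AE x in M. h x \<in> interior (eff_dom \<eta>)"
      using h(2) by (auto simp: entropy_deriv_in_Linfty_def)
    \<comment> \<open>This is the Bregman divergence of \<open>\<eta>\<close>.\<close>
    define B where "B x = ?e (f x) - ?e (h x) - ?d x * (f x - h x)" for x
    have fh: "integrable M (\<lambda>x. f x - h x)" using f h(1) by simp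
    note int = Linfty_mult_integrable[OF assms(4) f] Linfty_mult_integrable[OF assms(4) h(1)]
      Linfty_mult_integrable[OF assms(5) f] Linfty_mult_integrable[OF assms(5) h(1)]
      Linfty_mult_integrable[OF \<phi>_Linfty fh] Linfty_mult_integrable[OF d fh] ef(2) eh(1)
    have B_int: "integrable M B" unfolding B_def using int by simp
    have B_AE: "AE x in M. 0 \<le> B x \<and> (B x = 0 \<longrightarrow> f x = h x)"
      using ef(1) dom
    proof eventually_elim
      fix x assume "\<eta> (f x) < \<infinity>" and hx: "h x \<in> interior (eff_dom \<eta>)"
      then have "f x \<in> eff_dom \<eta>" by (simp add: eff_dom_def)
      from entropy_above_tangent[OF assms(1) hx this]
      show "0 \<le> B x \<and> (B x = 0 \<longrightarrow> f x = h x)"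
        by (cases "f x = h x") (auto simp: B_def)
    qed
    then have B_nonneg: "0 \<le> (\<integral>x. B x \<partial>M)" by (intro integral_nonneg_AE) (auto elim: eventually_mono)
    \<comment> \<open>Solving the optimality condition for the derivative of \<open>\<eta>\<close>
      at \<open>h\<close> turns the linear part of the divergence into the linear terms of
      \<open>J\<close> and the subgradient term.\<close>
    have "(\<integral>x. ?d x * (f x - h x) \<partial>M)
        = (\<integral>x. (k x * f x - k x * h x) - s * (G x * f x - G x * h x) - s * (\<phi> x * (f x - h x)) \<partial>M)"
    proof (rule integral_cong_AE)
      show "AE x in M. ?d x * (f x - h x)
          = (k x * f x - k x * h x) - s * (G x * f x - G x * h x) - s * (\<phi> x * (f x - h x))"
        using opt
      proof eventually_elim
        fix x assume "G x + (1 / s) * (?d x - k x) + \<phi> x = 0"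
        then have d: "?d x = k x - s * G x - s * \<phi> x" using assms(3) by (simp add: field_simps)
        show "?d x * (f x - h x)
            = (k x * f x - k x * h x) - s * (G x * f x - G x * h x) - s * (\<phi> x * (f x - h x))"
          unfolding d by (simp add: algebra_simps)
      qed
    qed (use int in \<open>auto intro!: borel_measurable_integrable\<close>)
    also have "\<dots> = ((\<integral>x. k x * f x \<partial>M) - (\<integral>x. k x * h x \<partial>M))
        - s * ((\<integral>x. G x * f x \<partial>M) - (\<integral>x. G x * h x \<partial>M)) - s * (\<integral>x. \<phi> x * (f x - h x) \<partial>M)"
      using int by simp
    finally have B_eq: "(\<integral>x. B x \<partial>M) = (\<integral>x. ?e (f x) \<partial>M) - (\<integral>x. ?e (h x) \<partial>M)
        - ((\<integral>x. k x * f x \<partial>M) - (\<integral>x. k x * h x \<partial>M))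
        + s * ((\<integral>x. G x * f x \<partial>M) - (\<integral>x. G x * h x \<partial>M)) + s * (\<integral>x. \<phi> x * (f x - h x) \<partial>M)"
      unfolding B_def using int by simp
    have "(\<integral>x. G x * f x \<partial>M) + (1 / s) * ((\<integral>x. ?e (f x) \<partial>M) - (\<integral>x. k x * f x \<partial>M))
        - ((\<integral>x. G x * h x \<partial>M) + (1 / s) * ((\<integral>x. ?e (h x) \<partial>M) - (\<integral>x. k x * h x \<partial>M)))
        + (\<integral>x. \<phi> x * (f x - h x) \<partial>M) = (\<integral>x. B x \<partial>M) / s"
      unfolding B_eq using assms(3) by (simp add: add_divide_distrib diff_divide_distrib)
    moreover have "a + (\<integral>x. \<phi> x * (f x - h x) \<partial>M) \<le> b" using subgrad a b by simp
    ultimately have gap: "(\<integral>x. G x * h x \<partial>M) + a + (1 / s) * ((\<integral>x. ?e (h x) \<partial>M) - (\<integral>x. k x * h x \<partial>M))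
        + (\<integral>x. B x \<partial>M) / s
      \<le> (\<integral>x. G x * f x \<partial>M) + b + (1 / s) * ((\<integral>x. ?e (f x) \<partial>M) - (\<integral>x. k x * f x \<partial>M))"
      by linarith
    moreover have "0 \<le> (\<integral>x. B x \<partial>M) / s" using B_nonneg assms(3) by simp
    ultimately have "J h \<le> J f" unfolding Jh Jf ereal_less_eq by linarith
    moreover have "AE x in M. f x = h x" if "J f \<le> J h"
    proof -
      have "(\<integral>x. B x \<partial>M) / s \<le> 0" using that gap unfolding Jh Jf ereal_less_eq by linarith
      then have "(\<integral>x. B x \<partial>M) = 0" using B_nonneg assms(3) by (simp add: divide_le_0_iff)
      then have "AE x in M. B x = 0"
        using integral_nonneg_eq_0_iff_AE[OF B_int] B_AE by (auto elim: eventually_mono)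
      then show ?thesis using B_AE by eventually_elim auto
    qed
    ultimately show ?thesis by blast
  qed
  then show "J h \<le> J f" and "J f \<le> J h \<Longrightarrow> AE x in M. f x = h x" by auto
qed

lemma LinftyI:
  assumes "f \<in> borel_measurable M" "\<And>x. \<bar>f x\<bar> \<le> C"
  shows "f \<in> Linfty M"
  using assms by (auto simp: Linfty_def)

text \<open>Multiplied by \<open>s\<close>, the condition asks for the derivative of
  \<open>\<eta>\<close> at \<open>h\<close> to be \<open>t - s * \<phi>\<close> with
  \<open>t = k - s * G\<close>. Shrinking \<open>t\<close> pointwise yields a subgradient for the
  norm weight \<open>m / s\<close>. Complementary slackness then turns it into a subgradient of
  \<open>H\<close>, whose norm weight is \<open>\<Lambda>\<close>.\<close>

lemma optimality_condition_solvable: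
  fixes H :: "('m \<Rightarrow> real) \<Rightarrow> ereal"
  assumes "A2 \<eta>" "prob_space M" "0 < s" "G \<in> Linfty M" "k \<in> Linfty M"
    and pq: "p \<longrightarrow> q" "0 \<le> \<Lambda>" "0 \<le> K" "p \<longrightarrow> K \<le> 1"
    and H: "\<And>f. integrable M f \<Longrightarrow> H f =
      (if (p \<longrightarrow> (\<integral>x. f x \<partial>M) = 1) \<and> (q \<longrightarrow> (AE x in M. 0 \<le> f x)) \<and> K * (\<integral>x. \<bar>f x\<bar> \<partial>M) \<le> 1
       then ereal (\<Lambda> * (\<integral>x. \<bar>f x\<bar> \<partial>M)) else \<infinity>)"
  obtains h \<phi> where "integrable M h" "entropy_deriv_in_Linfty M \<eta> h" "\<phi> \<in> subdiff M H h"
    "AE x in M. G x + (1 / s) * (entropy_deriv \<eta> (h x) - k x) + \<phi> x = 0"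
proof -
  interpret prob_space M by fact
  obtain C1 C2 where C12: "AE x in M. \<bar>G x\<bar> \<le> C1" "AE x in M. \<bar>k x\<bar> \<le> C2"
    and [measurable]: "G \<in> borel_measurable M" "k \<in> borel_measurable M"
    using assms(4,5) by (auto simp: Linfty_def)
  define C where "C = \<bar>C2\<bar> + s * \<bar>C1\<bar>"
  have C: "0 \<le> C" using assms(3) by (simp add: C_def)
  \<comment> \<open>Clipping gives a representative that is bounded at every point and not only
    almost everywhere, as the multiplier argument requires.\<close>
  define t where "t x = max (- C) (min C (k x - s * G x))" for x
  have [measurable]: "t \<in> borel_measurable M" unfolding t_def by simp
  have t_bound: "\<bar>t x\<bar> \<le> C" for x using C by (auto simp: t_def)
  have t_AE: "AE x in M. t x = k x - s * G x"
    using C12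
  proof eventually_elim
    fix x assume "\<bar>G x\<bar> \<le> C1" "\<bar>k x\<bar> \<le> C2"
    then have "\<bar>s * G x\<bar> \<le> s * \<bar>C1\<bar>" "\<bar>k x\<bar> \<le> \<bar>C2\<bar>"
      using assms(3) by (auto simp: abs_mult)
    then have "\<bar>k x - s * G x\<bar> \<le> C" unfolding C_def by linarith
    then show "t x = k x - s * G x" by (auto simp: t_def)
  qed
  \<comment> \<open>Scaling the condition by \<open>s\<close> turns the norm weight
    \<open>\<Lambda>\<close> into \<open>s * \<Lambda>\<close>.\<close>
  obtain m where m: "p \<and> (\<integral>x. \<bar>mirror_map \<eta> (shrink (A2_plus \<eta>) q m (t x))\<bar> \<partial>M) = 1 \<or>
      s * \<Lambda> \<le> m \<and> K * (\<integral>x. \<bar>mirror_map \<eta> (shrink (A2_plus \<eta>) q m (t x))\<bar> \<partial>M) \<le> 1 \<and>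
      (m = s * \<Lambda> \<or> K * (\<integral>x. \<bar>mirror_map \<eta> (shrink (A2_plus \<eta>) q m (t x))\<bar> \<partial>M) = 1) \<and> \<not> p"
    using multiplier_exists[where t = t and \<Lambda> = "s * \<Lambda>", OF assms(2,1) _ t_bound pq(1) _ pq(3,4)] pq(2) assms(3) by auto
  define T where "T x = shrink (A2_plus \<eta>) q m (t x)" for x
  define h where "h x = mirror_map \<eta> (T x)" for x
  define \<phi> where "\<phi> x = (t x - T x) / s" for x
  have [measurable]: "T \<in> borel_measurable M" unfolding T_def by simp
  have h_int: "integrable M h" unfolding h_def T_def
    by (rule integrable_mirror_map_shrink[OF finite_measure_axioms assms(1) _ t_bound]) simp
  have m': "p \<and> (\<integral>x. \<bar>h x\<bar> \<partial>M) = 1 \<or> s * \<Lambda> \<le> m \<and> K * (\<integral>x. \<bar>h x\<bar> \<partial>M) \<le> 1 \<and>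
      (m = s * \<Lambda> \<or> K * (\<integral>x. \<bar>h x\<bar> \<partial>M) = 1) \<and> \<not> p"
    using m by (simp add: h_def T_def)
  have T_bound: "\<bar>T x\<bar> \<le> C + \<bar>m\<bar>" for x
    using shrink_bound[of "A2_plus \<eta>" q m "t x"] t_bound[of x] by (simp add: T_def)
  have \<phi>_bound: "\<bar>\<phi> x\<bar> \<le> (2 * C + \<bar>m\<bar>) / s" for x
  proof -
    have "\<bar>t x - T x\<bar> \<le> 2 * C + \<bar>m\<bar>" using T_bound[of x] t_bound[of x] by linarith
    then show ?thesis using assms(3) by (simp add: \<phi>_def divide_right_mono)
  qed
  have "\<phi> \<in> borel_measurable M" unfolding \<phi>_def by simp
  then have \<phi>_Linfty: "\<phi> \<in> Linfty M"
    using \<phi>_bound by (intro LinftyI)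
  have h_deriv: "entropy_deriv_in_Linfty M \<eta> h"
    unfolding entropy_deriv_in_Linfty_def h_def mirror_map(2)[OF assms(1)]
    using mirror_map(1)[OF assms(1)] LinftyI[of T, OF _ T_bound] by simp
  have h_nonneg: "0 \<le> h x" if q for x
    unfolding h_def T_def using assms(1) that by (intro mirror_map_shrink_nonneg) auto
  have h_mass: "(\<integral>x. h x \<partial>M) = (\<integral>x. \<bar>h x\<bar> \<partial>M)" if q
    using h_nonneg[OF that] by (intro Bochner_Integration.integral_cong) auto
  have Hh: "H h = ereal (\<Lambda> * (\<integral>x. \<bar>h x\<bar> \<partial>M))"
  proof -
    have "p \<longrightarrow> (\<integral>x. h x \<partial>M) = 1" using m' h_mass pq(1) by metis
    moreover have "q \<longrightarrow> (AE x in M. 0 \<le> h x)" using h_nonneg by blast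
    moreover have "K * (\<integral>x. \<bar>h x\<bar> \<partial>M) \<le> 1" using m' pq(4) by (metis mult.right_neutral)
    ultimately show ?thesis unfolding H[OF h_int] by presburger
  qed
  have "H h + ereal (\<integral>x. \<phi> x * (g x - h x) \<partial>M) \<le> H g" if g: "integrable M g" for g
  proof (cases "H g = \<infinity>")
    case False
    then have Hg: "H g = ereal (\<Lambda> * (\<integral>x. \<bar>g x\<bar> \<partial>M))"
      and g_p: "p \<longrightarrow> (\<integral>x. g x \<partial>M) = 1" and g_q: "q \<longrightarrow> (AE x in M. 0 \<le> g x)"
      and g_K: "K * (\<integral>x. \<bar>g x\<bar> \<partial>M) \<le> 1"
      using H[OF g] by (auto split: if_splits)
    have "q \<or> 0 \<le> m" using m' pq(1,2) assms(3) by (auto intro: order_trans[of 0 "s * \<Lambda>"])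
    have "AE x in M. q \<longrightarrow> 0 \<le> g x" using g_q by auto
    then have "AE x in M. \<phi> x * (g x - h x) \<le> m / s * (\<bar>g x\<bar> - \<bar>h x\<bar>)"
    proof eventually_elim
      fix x assume "q \<longrightarrow> 0 \<le> g x"
      from shrink_subgradient[OF assms(1) \<open>q \<or> 0 \<le> m\<close> this, of "t x"]
      show "\<phi> x * (g x - h x) \<le> m / s * (\<bar>g x\<bar> - \<bar>h x\<bar>)"
        using assms(3) by (simp add: \<phi>_def h_def T_def divide_right_mono)
    qed
    then have "(\<integral>x. \<phi> x * (g x - h x) \<partial>M) \<le> (\<integral>x. m / s * (\<bar>g x\<bar> - \<bar>h x\<bar>) \<partial>M)"
      using g h_int by (intro integral_mono_AE Linfty_mult_integrable[OF \<phi>_Linfty]) auto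
    also have "\<dots> = m / s * ((\<integral>x. \<bar>g x\<bar> \<partial>M) - (\<integral>x. \<bar>h x\<bar> \<partial>M))" using g h_int by simp
    \<comment> \<open>Under the mass constraint both norms are 1. Otherwise either
      \<open>m / s = \<Lambda>\<close>, or \<open>h\<close> lies on the sphere bounding the ball:
      then the difference of norms is at most 0 and \<open>m / s\<close> is at least
      \<open>\<Lambda>\<close>.\<close>
    also have "\<dots> \<le> \<Lambda> * ((\<integral>x. \<bar>g x\<bar> \<partial>M) - (\<integral>x. \<bar>h x\<bar> \<partial>M))"
    proof (cases p)
      case True
      then have "(\<integral>x. \<bar>g x\<bar> \<partial>M) = (\<integral>x. g x \<partial>M)"
        using g_q pq(1) g by (intro integral_cong_AE) (auto elim: eventually_mono)
      then show ?thesis using True g_p m' by simp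
    next
      case False
      then consider "m = s * \<Lambda>" | "s * \<Lambda> \<le> m" "K * (\<integral>x. \<bar>h x\<bar> \<partial>M) = 1" using m' by blast
      then show ?thesis
      proof cases
        case 2
        then have "0 < K" using pq(3) by (cases "K = 0") auto
        then have "(\<integral>x. \<bar>g x\<bar> \<partial>M) \<le> (\<integral>x. \<bar>h x\<bar> \<partial>M)"
          using g_K 2(2) by (metis mult_le_cancel_left_pos)
        moreover have "\<Lambda> \<le> m / s" using 2(1) assms(3) by (simp add: field_simps)
        ultimately show ?thesis by (intro mult_right_mono_neg) auto
      qed (use assms(3) in simp)
    qed
    finally show ?thesis by (simp add: Hg Hh algebra_simps)
  qed simp
  then have "\<phi> \<in> subdiff M H h" using \<phi>_Linfty Hh by (simp add: subdiff_def)
  moreover have "AE x in M. G x + (1 / s) * (entropy_deriv \<eta> (h x) - k x) + \<phi> x = 0"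
    using t_AE
  proof eventually_elim
    fix x assume "t x = k x - s * G x"
    then have k: "k x = t x + s * G x" by simp
    show "G x + (1 / s) * (entropy_deriv \<eta> (h x) - k x) + \<phi> x = 0"
      unfolding \<phi>_def h_def mirror_map(2)[OF assms(1)] k using assms(3) by (simp add: field_simps)
  qed
  ultimately show thesis using that h_int h_deriv by blast
qed

section \<open>Boundedness of the linear term, change of representative, and the theorem\<close>

lemma G_deriv_Linfty:
  fixes \<tau> :: "'m::topological_space measure"
  assumes "compact (UNIV :: 'm set)" "sets \<tau> = sets borel" "continuous_on UNIV \<Phi>"
  shows "G_deriv \<Phi> R \<tau> g \<in> Linfty \<tau>"
proof -
  have cont: "continuous_on UNIV (G_deriv \<Phi> R \<tau> g)"
    unfolding G_deriv_def using assms(3) by (intro continuous_intros)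
  then have "bounded (range (G_deriv \<Phi> R \<tau> g))"
    using compact_continuous_image[OF _ assms(1)] compact_imp_bounded by blast
  then obtain C where "\<And>x. \<bar>G_deriv \<Phi> R \<tau> g x\<bar> \<le> C" by (auto simp: bounded_iff)
  moreover have "G_deriv \<Phi> R \<tau> g \<in> borel_measurable \<tau>"
    using borel_measurable_continuous_onI[OF cont] measurable_cong_sets[OF assms(2) refl] by blast
  ultimately show ?thesis by (auto simp: Linfty_def)
qed

lemma entropy_deriv_in_Linfty_cong_AE:
  assumes "A2 \<eta>" "f \<in> borel_measurable M" "AE x in M. f x = h x" "entropy_deriv_in_Linfty M \<eta> h"
  shows "entropy_deriv_in_Linfty M \<eta> f"
proof -
  note [measurable] = assms(2) borel_measurable_entropy(1)[OF assms(1)]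
  obtain C where "AE x in M. \<bar>entropy_deriv \<eta> (h x)\<bar> \<le> C" "AE x in M. h x \<in> interior (eff_dom \<eta>)"
    using assms(4) by (auto simp: entropy_deriv_in_Linfty_def Linfty_def)
  then have "AE x in M. \<bar>entropy_deriv \<eta> (f x)\<bar> \<le> C" "AE x in M. f x \<in> interior (eff_dom \<eta>)"
    using assms(3) by (auto elim: eventually_elim2)
  then show ?thesis by (auto simp: entropy_deriv_in_Linfty_def Linfty_def)
qed

text \<open>Together with the preceding lemma this moves the optimality condition between
  representatives of one class, keeping the same \<open>\<phi>\<close>.\<close>

lemma subdiff_cong_AE:
  assumes "H f = H h" "integrable M f" "integrable M h" "AE x in M. f x = h x" "\<phi> \<in> subdiff M H h"
  shows "\<phi> \<in> subdiff M H f"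
proof -
  have "(\<integral>x. \<phi> x * (g x - f x) \<partial>M) = (\<integral>x. \<phi> x * (g x - h x) \<partial>M)" if "integrable M g" for g
    using assms that by (intro integral_cong_AE) (auto simp: subdiff_def Linfty_def elim: eventually_mono)
  then show ?thesis using assms(1,5) by (auto simp: subdiff_def)
qed

theorem proposition3p3:
  fixes \<A> :: "('m::t2_space, 'n::finite) chart set"
    and metric :: "('m, 'n) local_metric"
    and \<tau> :: "'m measure"
    and \<Phi> :: "'m \<Rightarrow> 'f::{real_inner, complete_space}"
    and R :: "'f \<Rightarrow> real"
    and Hbar :: "('m set \<Rightarrow> real) \<Rightarrow> ereal"
    and \<eta> :: "real \<Rightarrow> ennreal"
    and s :: real
    and h\<^sub>k g\<^sub>k :: "'m \<Rightarrow> real"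
  defines "solution \<equiv> is_arg_min (step_objective \<tau> \<Phi> R Hbar \<eta> s g\<^sub>k h\<^sub>k) (integrable \<tau>)"
  assumes "compact_riemannian_manifold \<A> metric"
    and "is_normalized_volume \<A> metric \<tau>"
    and "A1 \<Phi> R Hbar"
    and "A2 \<eta>"
    and "0 < s"
    and "h\<^sub>k \<in> borel_measurable \<tau>"
    and "entropy_deriv_in_Linfty \<tau> \<eta> h\<^sub>k"
    and "integrable \<tau> g\<^sub>k"
  shows "(\<exists>h. solution h \<and> (\<forall>f. solution f \<longrightarrow> (AE x in \<tau>. f x = h x))
              \<and> entropy_deriv_in_Linfty \<tau> \<eta> h)
    \<and> (\<forall>h. integrable \<tau> h \<longrightarrow>
         (solution h \<longleftrightarrow>
            entropy_deriv_in_Linfty \<tau> \<eta> h \<and>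
            (\<exists>\<phi>\<in>subdiff \<tau> (H_fun Hbar \<tau>) h. AE x in \<tau>.
               G_deriv \<Phi> R \<tau> g\<^sub>k x + (1 / s) * (entropy_deriv \<eta> (h x) - entropy_deriv \<eta> (h\<^sub>k x)) + \<phi> x = 0)))"
proof -
  have prob: "prob_space \<tau>" and sets: "sets \<tau> = sets borel"
    using assms(3) by (auto simp: is_normalized_volume_def is_volume_measure_def)
  then interpret prob_space \<tau> by simp
  let ?G = "G_deriv \<Phi> R \<tau> g\<^sub>k" and ?k = "\<lambda>x. entropy_deriv \<eta> (h\<^sub>k x)" and ?H = "H_fun Hbar \<tau>"
  let ?J = "step_objective \<tau> \<Phi> R Hbar \<eta> s g\<^sub>k h\<^sub>k"
  let ?opt = "\<lambda>h. entropy_deriv_in_Linfty \<tau> \<eta> h \<and> (\<exists>\<phi>\<in>subdiff \<tau> ?H h. AE x in \<tau>.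
      ?G x + (1 / s) * (entropy_deriv \<eta> (h x) - ?k x) + \<phi> x = 0)"
  have G: "?G \<in> Linfty \<tau>"
    using assms(2,4) sets by (intro G_deriv_Linfty) (auto simp: compact_riemannian_manifold_def A1_def)
  have k: "?k \<in> Linfty \<tau>" using assms(8) by (simp add: entropy_deriv_in_Linfty_def)
  obtain p q \<Lambda> K where pq: "p \<longrightarrow> q" "0 \<le> \<Lambda>" "0 \<le> K" "p \<longrightarrow> K \<le> 1" and
    H: "\<And>f. integrable \<tau> f \<Longrightarrow> ?H f =
      (if (p \<longrightarrow> (\<integral>x. f x \<partial>\<tau>) = 1) \<and> (q \<longrightarrow> (AE x in \<tau>. 0 \<le> f x)) \<and> K * (\<integral>x. \<bar>f x\<bar> \<partial>\<tau>) \<le> 1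
       then ereal (\<Lambda> * (\<integral>x. \<bar>f x\<bar> \<partial>\<tau>)) else \<infinity>)"
    by (rule H_fun_L1[OF assms(4) prob sets]) blast
  have H_nonneg: "0 \<le> ?H f" if "integrable \<tau> f" for f using H[OF that] pq(2) by simp
  have optimal: "?J h \<le> ?J f" "?J f \<le> ?J h \<Longrightarrow> AE x in \<tau>. f x = h x"
    if h: "integrable \<tau> h" "?opt h" and f: "integrable \<tau> f" for h f
  proof -
    obtain \<phi> where \<phi>: "\<phi> \<in> subdiff \<tau> ?H h"
      "AE x in \<tau>. ?G x + (1 / s) * (entropy_deriv \<eta> (h x) - ?k x) + \<phi> x = 0"
      using h(2) by blast
    note opt = optimality_condition_sufficient[OF assms(5) finite_measure_axioms assms(6) G k H_nonneg h(1)
        conjunct1[OF h(2)] \<phi> f, folded step_objective_def]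
    show "?J h \<le> ?J f" "?J f \<le> ?J h \<Longrightarrow> AE x in \<tau>. f x = h x" using opt by auto
  qed
  have sufficient: "solution h" if "integrable \<tau> h" "?opt h" for h
    unfolding solution_def is_arg_min_def using that(1) optimal(1)[OF that] leD by blast
  obtain h where h: "integrable \<tau> h" "?opt h"
    by (rule optimality_condition_solvable[OF assms(5) prob assms(6) G k pq H]) blast+
  have unique: "integrable \<tau> f" "AE x in \<tau>. f x = h x" if "solution f" for f
    using that optimal(2)[OF h, of f] h(1) not_less unfolding solution_def is_arg_min_def by blast+
  \<comment> \<open>Necessity: a solution agrees almost everywhere with the point \<open>h\<close>
    exhibited above and inherits its subgradient.\<close>
  have "?opt f" if "solution f" for f
  proof -
    note f = unique[OF that]
    obtain \<phi> where \<phi>: "\<phi> \<in> subdiff \<tau> ?H h"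
      "AE x in \<tau>. ?G x + (1 / s) * (entropy_deriv \<eta> (h x) - ?k x) + \<phi> x = 0"
      using h(2) by blast
    have "?H f = ?H h" by (simp add: H_fun_def density_signed_cong_AE[OF sets f(1) h(1) f(2)])
    then have "\<phi> \<in> subdiff \<tau> ?H f" using f(1) h(1) f(2) \<phi>(1) by (rule subdiff_cong_AE)
    moreover have "AE x in \<tau>. ?G x + (1 / s) * (entropy_deriv \<eta> (f x) - ?k x) + \<phi> x = 0"
      using \<phi>(2) f(2) by eventually_elim simp
    ultimately show ?thesis
      using entropy_deriv_in_Linfty_cong_AE[OF assms(5) _ f(2)] f(1) h(2) by blast
  qed
  then show ?thesis using sufficient[OF h] unique(2) h(2) sufficient by blast
qed

end
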